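(* Let $dM(\lambda)$ be a (locally finite nonnegative) measure on $[0,\infty)$ satisfying $$\int_0^\infty e^{-t\lambda}\,dM(\lambda)<\infty\quad\text{for all } t>0.$$ Let $A_0:L^2(\mathbb R_+)\to L^2(M)$ be the operator defined on the domain $\mathcal D(A_0)=\mathcal E$ (or $\mathcal D(A_0)=C_0^\infty(\mathbb R_+)$) by $A_0f=\mathsf L f$. Then $A_0$ admits the closure if and only if $M(\{0\})=0$. If $M(\{0\})=0$ and $$\int_0^\infty(1+\lambda)^{-k}\,dM(\lambda)<\infty\quad\text{for some } k>0,$$ then the closure $A:=\bar A_0$ is given by the same equality $Af=\mathsf L f$ on the domain $\mathcal D(A)$ which consists of all $f\in L^2(\mathbb R_+)$ such that $\mathsf L f\in L^2(M)$.
   Context: $\mathbb R_+=(0,\infty)$; $L^2(M)=L^2([0,\infty);dM)$; integrals $\int_0^\infty\dots dM$ are over $[0,\infty)$. $\mathsf L$ is the Laplace transform $(\mathsf L f)(\lambda)=\int_0^\infty e^{-t\lambda}f(t)\,dt$. $\mathcal E$ is the set of functions $f\in L^2(\mathbb R_+)$ compactly supported in $\mathbb R_+$ (i.e. vanishing outside a compact subset of the open half-line). For $f\in\mathcal E$ the function $\mathsf L f$ is continuous on $[0,\infty)$ and belongs to $L^2(M)$; for general $f\in L^2(\mathbb R_+)$, $(\mathsf L f)(\lambda)$ is defined for all $\lambda>0$. *)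

theory Defs
  imports "HOL-Analysis.Analysis"
begin

text \<open>
  Elements of the complex Hilbert space $L^2(M)$ are handled through representatives: two elements
  of \<open>l2 M\<close> denote the same vector iff they agree \<open>M\<close>-almost everywhere.  A (possibly unbounded,
  possibly multivalued) map from $L^2(N)$ to $L^2(M)$ is given by its graph, a set of pairs of
  representatives.
\<close>

definition l2 :: "'a measure \<Rightarrow> ('a \<Rightarrow> complex) set" where
  "l2 M = {f \<in> borel_measurable M. integrable M (\<lambda>x. (cmod (f x))\<^sup>2)}"

definition l2_norm :: "'a measure \<Rightarrow> ('a \<Rightarrow> complex) \<Rightarrow> real" where
  "l2_norm M f = sqrt (\<integral>x. (cmod (f x))\<^sup>2 \<partial>M)"

text \<open>
  Graph of the operator that acts by \<open>T\<close> on the domain \<open>D\<close>, closed under almost-everywhere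
  equality in both components.  This is meant for \<open>D \<subseteq> l2 N\<close> and \<open>T ` D \<subseteq> l2 M\<close>; see the lemmas
  \<open>E_plus_subset_l2\<close>, \<open>C0_inf_plus_subset_E_plus\<close> and \<open>laplace_E_plus_in_l2\<close> below.
\<close>

definition l2_graph ::
    "'a measure \<Rightarrow> 'b measure \<Rightarrow> ('a \<Rightarrow> complex) set \<Rightarrow> (('a \<Rightarrow> complex) \<Rightarrow> 'b \<Rightarrow> complex)
      \<Rightarrow> (('a \<Rightarrow> complex) \<times> ('b \<Rightarrow> complex)) set" where
  "l2_graph N M D T =
     {(f, g). f \<in> l2 N \<and> g \<in> l2 M \<and>
        (\<exists>h\<in>D. (AE x in N. f x = h x) \<and> (AE y in M. g y = T h y))}"

definition l2_closure ::
    "'a measure \<Rightarrow> 'b measure \<Rightarrow> (('a \<Rightarrow> complex) \<times> ('b \<Rightarrow> complex)) set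
      \<Rightarrow> (('a \<Rightarrow> complex) \<times> ('b \<Rightarrow> complex)) set" where
  "l2_closure N M G =
     {(f, g). f \<in> l2 N \<and> g \<in> l2 M \<and>
        (\<exists>u v. (\<forall>n. (u n, v n) \<in> G) \<and>
               (\<lambda>n::nat. l2_norm N (\<lambda>x. u n x - f x)) \<longlonglongrightarrow> 0 \<and>
               (\<lambda>n::nat. l2_norm M (\<lambda>y. v n y - g y)) \<longlonglongrightarrow> 0)}"

text \<open>\<open>G\<close> is the graph of a single-valued map between subsets of $L^2(N)$ and $L^2(M)$.\<close>

definition l2_single_valued ::
    "'a measure \<Rightarrow> 'b measure \<Rightarrow> (('a \<Rightarrow> complex) \<times> ('b \<Rightarrow> complex)) set \<Rightarrow> bool" where
  "l2_single_valued N M G \<longleftrightarrow>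
     (\<forall>f g f' g'. (f, g) \<in> G \<longrightarrow> (f', g') \<in> G \<longrightarrow>
        (AE x in N. f x = f' x) \<longrightarrow> (AE y in M. g y = g' y))"

text \<open>An operator admits the closure iff the closure of its graph is again the graph of an operator.\<close>

definition l2_closable ::
    "'a measure \<Rightarrow> 'b measure \<Rightarrow> (('a \<Rightarrow> complex) \<times> ('b \<Rightarrow> complex)) set \<Rightarrow> bool" where
  "l2_closable N M G \<longleftrightarrow> l2_single_valued N M (l2_closure N M G)"

abbreviation R_plus :: "real measure" where
  "R_plus \<equiv> restrict_space lborel {0<..}"

text \<open>
  For \<open>f \<in> l2 R_plus\<close> the integral converges absolutely for every \<open>s > 0\<close>.  At \<open>s = 0\<close> it may
  diverge, in which case the Bochner integral returns the default value 0.
\<close>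

definition laplace :: "(real \<Rightarrow> complex) \<Rightarrow> real \<Rightarrow> complex" where
  "laplace f s = (\<integral>t. complex_of_real (exp (- (t * s))) * f t \<partial>R_plus)"

definition E_plus :: "(real \<Rightarrow> complex) set" where
  "E_plus = {f \<in> l2 R_plus. \<exists>K. compact K \<and> K \<subseteq> {0<..} \<and> (AE t in R_plus. t \<notin> K \<longrightarrow> f t = 0)}"

text \<open>Values of \<open>f\<close> on the complement of the open half-line are irrelevant.\<close>

definition C0_inf_plus :: "(real \<Rightarrow> complex) set" where
  "C0_inf_plus =
     {f. (\<forall>n. ((\<lambda>g t. vector_derivative g (at t)) ^^ n) f differentiable_on {0<..}) \<and>
         (\<exists>K. compact K \<and> K \<subseteq> {0<..} \<and> (\<forall>t\<in>{0<..} - K. f t = 0))}"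

lemma E_plus_subset_l2: "E_plus \<subseteq> l2 R_plus"
  by (auto simp: E_plus_def)

lemma C0_inf_plus_subset_E_plus: "C0_inf_plus \<subseteq> E_plus"
proof
  fix f assume f: "f \<in> C0_inf_plus"
  then obtain K where K: "compact K" "K \<subseteq> {0<..}" "\<And>t. t > 0 \<Longrightarrow> t \<notin> K \<Longrightarrow> f t = 0"
    by (auto simp: C0_inf_plus_def)
  have "((\<lambda>g t. vector_derivative g (at t)) ^^ 0) f differentiable_on {0<..}"
    using f unfolding C0_inf_plus_def by blast
  then have c: "continuous_on {0<..} f"
    by (simp add: differentiable_imp_continuous_on)
  have m: "f \<in> borel_measurable R_plus"
    using borel_measurable_continuous_on_restrict[OF c]
    by (simp add: measurable_def space_restrict_space sets_restrict_space)
  have "set_integrable lborel K (\<lambda>t. (cmod (f t))\<^sup>2)"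
    unfolding set_integrable_def
    by (intro borel_integrable_compact K continuous_intros continuous_on_subset[OF c])
  moreover have "(\<lambda>t. indicator K t *\<^sub>R (cmod (f t))\<^sup>2) = (\<lambda>t. indicator {0<..} t *\<^sub>R (cmod (f t))\<^sup>2)"
    using K(2,3) by (force simp: indicator_def)
  ultimately have "integrable R_plus (\<lambda>t. (cmod (f t))\<^sup>2)"
    by (simp only: integrable_restrict_space set_integrable_def) (simp add: integrable_restrict_space set_integrable_def)
  with m K show "f \<in> E_plus"
    unfolding E_plus_def l2_def by (auto intro!: exI[of _ K] AE_I2 simp: space_restrict_space)
qed

lemma laplace_E_plus_in_l2:
  assumes f: "f \<in> E_plus"
    and sets: "sets M = sets (restrict_space borel {0..})"
    and exp: "\<And>t. t > 0 \<Longrightarrow> (\<integral>\<^sup>+s. ennreal (exp (- (t * s))) \<partial>M) < \<infinity>"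
  shows "laplace f \<in> l2 M"
proof -
  obtain K where K: "compact K" "K \<subseteq> {0<..}" "AE t in R_plus. t \<notin> K \<longrightarrow> f t = 0"
    using f by (auto simp: E_plus_def)
  have mf [measurable]: "f \<in> borel_measurable R_plus"
    and i2: "integrable R_plus (\<lambda>t. (cmod (f t))\<^sup>2)"
    using f by (auto simp: E_plus_def l2_def)
  obtain a where a: "a > 0" "\<And>t. t \<in> K \<Longrightarrow> a \<le> t"
  proof (cases "K = {}")
    case True then show ?thesis using that[of 1] by auto
  next
    case False
    then obtain s where "s \<in> K" "\<forall>t\<in>K. s \<le> t"
      using compact_attains_inf[OF K(1)] by blast
    then show ?thesis using that[of s] K(2) by auto
  qed
  have spM: "space M = {0..}"
    using sets_eq_imp_space_eq[OF sets] by (simp add: space_restrict_space)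
  have [measurable]: "K \<in> sets R_plus"
    using K by (auto simp: sets_restrict_space intro!: image_eqI[of _ _ K] borel_compact)
  have "emeasure R_plus K = emeasure lborel K"
    using K by (intro emeasure_restrict_space) auto
  also have "\<dots> < \<infinity>" by (rule emeasure_compact_finite[OF K(1)])
  finally have iK: "integrable R_plus (indicator K :: real \<Rightarrow> real)"
    by (intro integrable_real_indicator) auto
  have i1: "integrable R_plus (\<lambda>t. cmod (f t))"
  proof (rule Bochner_Integration.integrable_bound[OF Bochner_Integration.integrable_add[OF iK i2]])
    show "AE t in R_plus. norm (cmod (f t)) \<le> norm (indicator K t + (cmod (f t))\<^sup>2)"
      using K(3)
    proof (eventually_elim)
      case (elim t)
      have "cmod (f t) \<le> 1 + (cmod (f t))\<^sup>2"
        using sum_squares_bound[of "cmod (f t)" 1] by (simp; smt (verit) norm_ge_zero)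
      then show ?case using elim by (cases "t \<in> K") auto
    qed
  qed auto
  define C where "C = (\<integral>t. cmod (f t) \<partial>R_plus)"
  have C0: "C \<ge> 0" unfolding C_def by (rule Bochner_Integration.integral_nonneg) simp
  have bound: "cmod (laplace f l) \<le> exp (- (a * l)) * C" if "l \<ge> 0" for l
  proof -
    have le: "AE t in R_plus. cmod (complex_of_real (exp (- (t * l))) * f t) \<le> exp (- (a * l)) * cmod (f t)"
      using K(3)
    proof eventually_elim
      case (elim t)
      then show ?case
        using a(2)[of t] that by (cases "t \<in> K") (auto simp: norm_mult intro!: mult_right_mono)
    qed
    have ig: "integrable R_plus (\<lambda>t. exp (- (a * l)) * cmod (f t))" using i1 by simp
    have "(\<lambda>t. t) \<in> borel_measurable R_plus" by (rule measurable_restrict_space1) simp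
    then have mm: "(\<lambda>t. complex_of_real (exp (- (t * l))) * f t) \<in> borel_measurable R_plus"
      by measurable
    have ii: "integrable R_plus (\<lambda>t. complex_of_real (exp (- (t * l))) * f t)"
      by (rule Bochner_Integration.integrable_bound[OF ig mm]) (use le in \<open>auto elim: eventually_mono\<close>)
    have "cmod (laplace f l) \<le> (\<integral>t. cmod (complex_of_real (exp (- (t * l))) * f t) \<partial>R_plus)"
      unfolding laplace_def by (rule integral_norm_bound)
    also have "\<dots> \<le> (\<integral>t. exp (- (a * l)) * cmod (f t) \<partial>R_plus)"
      by (rule integral_mono_AE[OF integrable_norm[OF ii] ig le])
    finally have "cmod (laplace f l) \<le> (\<integral>t. exp (- (a * l)) * cmod (f t) \<partial>R_plus)" .
    then show ?thesis by (simp add: C_def)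
  qed
  have sf: "sigma_finite_measure R_plus"
    by (rule sigma_finite_measure_restrict_space[OF lborel.sigma_finite_measure_axioms]) auto
  have mfst: "(fst :: real \<times> real \<Rightarrow> real) \<in> borel_measurable (borel \<Otimes>\<^sub>M R_plus)"
    by (rule measurable_fst)
  have "(\<lambda>t. t) \<in> borel_measurable R_plus" by (rule measurable_restrict_space1) simp
  then have msnd: "(snd :: real \<times> real \<Rightarrow> real) \<in> borel_measurable (borel \<Otimes>\<^sub>M R_plus)"
    using measurable_compose[OF measurable_snd] by fastforce
  have mfs: "(\<lambda>x::real \<times> real. f (snd x)) \<in> borel_measurable (borel \<Otimes>\<^sub>M R_plus)"
    by (rule measurable_compose[OF measurable_snd mf])
  have "(\<lambda>x. snd x * fst x) \<in> borel_measurable (borel \<Otimes>\<^sub>M R_plus)"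
    by (rule borel_measurable_times[OF msnd mfst])
  then have mex: "(\<lambda>x. complex_of_real (exp (- (snd x * fst x)))) \<in> borel_measurable (borel \<Otimes>\<^sub>M R_plus)"
    by measurable
  have mprod: "(\<lambda>(l, t). complex_of_real (exp (- (t * l))) * f t) \<in> borel_measurable (borel \<Otimes>\<^sub>M R_plus)"
    unfolding split_beta by (rule borel_measurable_times[OF mex mfs])
  have "(\<lambda>l. laplace f l) \<in> borel_measurable borel"
    unfolding laplace_def
    by (rule sigma_finite_measure.borel_measurable_lebesgue_integral[OF sf mprod])
  then have mL [measurable]: "laplace f \<in> borel_measurable M"
    unfolding measurable_cong_sets[OF sets refl] by (rule measurable_restrict_space1)
  have mid: "(\<lambda>l. l) \<in> borel_measurable M"
    unfolding measurable_cong_sets[OF sets refl] by (rule measurable_restrict_space1) simp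
  have "integrable M (\<lambda>l. exp (- ((2 * a) * l)))"
  proof (rule integrableI_bounded)
    show "(\<lambda>l. exp (- ((2 * a) * l))) \<in> borel_measurable M" using mid by measurable
    show "(\<integral>\<^sup>+l. ennreal (norm (exp (- ((2 * a) * l)))) \<partial>M) < \<infinity>"
      using exp[of "2 * a"] a by simp
  qed
  then have iC: "integrable M (\<lambda>l. C\<^sup>2 * exp (- ((2 * a) * l)))" by simp
  have "integrable M (\<lambda>l. (cmod (laplace f l))\<^sup>2)"
  proof (rule Bochner_Integration.integrable_bound[OF iC])
    show "AE l in M. norm ((cmod (laplace f l))\<^sup>2) \<le> norm (C\<^sup>2 * exp (- ((2 * a) * l)))"
    proof (rule AE_I2)
      fix l assume "l \<in> space M"
      then have "(cmod (laplace f l))\<^sup>2 \<le> (exp (- (a * l)) * C)\<^sup>2"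
        using bound[of l] spM by (intro power_mono) auto
      also have "\<dots> = C\<^sup>2 * exp (- ((2 * a) * l))"
        by (simp add: power_mult_distrib power2_eq_square exp_add[symmetric] algebra_simps)
      finally show "norm ((cmod (laplace f l))\<^sup>2) \<le> norm (C\<^sup>2 * exp (- ((2 * a) * l)))" by simp
    qed
  qed measurable
  then show ?thesis using mL by (simp add: l2_def)
qed

end

theory Submission
  imports Defs
begin

text \<open>
  Point evaluation of the transform at \<open>s > 0\<close> is a bounded functional, with
  \<open>cmod (laplace f s) \<le> l2_norm R_plus f / sqrt (2 * s)\<close>, by the Cauchy-Schwarz inequality.  Hence a limit
  \<open>(f, g)\<close> of pairs \<open>(u n, laplace (u n))\<close> satisfies \<open>g s = laplace f s\<close> for almost all \<open>s > 0\<close>.  If \<open>{0}\<close> is a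
  null set, this says that the closure is single-valued and is contained in the graph of the transform
  on its maximal domain (\<open>closure_graph_is_laplace\<close>).  If \<open>{0}\<close> carries mass, the functions
  \<open>1 / n\<close> on \<open>{n..2 * n}\<close> tend to \<open>0\<close> while their transforms tend to the indicator of \<open>{0}\<close>, which is not the
  zero vector (\<open>closable_imp_null\<close>).

  Both initial domains lead to the same closure: a function in \<open>E_plus\<close> is a limit of smooth functions
  whose supports stay in one compact subset of the open half-line, and on functions supported there the
  transform is bounded into \<open>l2 M\<close> (\<open>smooth_approximation\<close>, \<open>closure_graph_C0_inf_plus\<close>).

  The main point is that every \<open>f\<close> with \<open>laplace f \<in> l2 M\<close> belongs to the domain of the closure.
  Truncating \<open>f\<close> gives no control in \<open>l2 M\<close>: the error of the transforms is bounded by a multiple of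
  \<open>1 / sqrt s\<close>, which may fail to be square-integrable both near \<open>0\<close> and at infinity.  The function is
  therefore first regularised by translations, because a translation by \<open>a \<ge> 0\<close> multiplies the transform
  by \<open>exp (- (a * s)) \<le> 1\<close>, an operation that does not leave \<open>l2 M\<close>.  The operator \<open>mollify n\<close> subtracts
  from \<open>f\<close> the mean of its translates by \<open>n, 2 * n, \<dots>, n * n\<close> and translates the result by \<open>1 / n\<close>.
  Its symbol (the factor by which it multiplies transforms) lies between \<open>0\<close> and \<open>1\<close>, tends to \<open>1\<close> at
  every \<open>s > 0\<close>, vanishes linearly at \<open>0\<close> and decays exponentially.  When \<open>{0}\<close> is a null set, this gives
  two facts.

  \<^item> For fixed \<open>n\<close>, the two kinds of decay make \<open>laplace \<circ> mollify n\<close> bounded from all of \<open>l2 R_plus\<close> into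
    \<open>l2 M\<close>.  So \<open>mollify n f\<close>, together with its transform, is the limit of \<open>mollify n\<close> applied to truncations of \<open>f\<close>,
    and those are in \<open>E_plus\<close> (\<open>mollify_in_closure\<close>).

  \<^item> As \<open>n\<close> grows, \<open>mollify n f\<close> tends to \<open>f\<close> (\<open>mollify_tendsto\<close>): translations are strongly continuous, and the mean of
    distant translates is small because these are almost orthogonal.  The transforms tend to \<open>laplace f\<close>
    by dominated convergence, as \<open>{0}\<close> is a null set (\<open>maximal_in_closure\<close>).
\<close>

section \<open>Square-integrable functions and closures of graphs\<close>

lemma l2_measurable: "f \<in> l2 M \<Longrightarrow> f \<in> borel_measurable M"
  by (simp add: l2_def)

lemma l2_integrable: "f \<in> l2 M \<Longrightarrow> integrable M (\<lambda>x. (cmod (f x))\<^sup>2)"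
  by (simp add: l2_def)

lemma l2_norm_nonneg: "0 \<le> l2_norm M f"
  by (simp add: l2_norm_def)

lemma l2_norm_squared: "(l2_norm M f)\<^sup>2 = (\<integral>x. (cmod (f x))\<^sup>2 \<partial>M)"
  by (simp add: l2_norm_def)

lemma l2_norm_minus_commute: "l2_norm M (\<lambda>x. f x - g x) = l2_norm M (\<lambda>x. g x - f x)"
  by (simp add: l2_norm_def norm_minus_commute)

lemma l2_norm_cong_AE:
  assumes "f \<in> borel_measurable M" "g \<in> borel_measurable M" "AE x in M. cmod (f x) = cmod (g x)"
  shows "l2_norm M f = l2_norm M g"
proof -
  have "(\<integral>x. (cmod (f x))\<^sup>2 \<partial>M) = (\<integral>x. (cmod (g x))\<^sup>2 \<partial>M)"
    by (rule integral_cong_AE) (use assms in \<open>auto elim: eventually_mono\<close>)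
  then show ?thesis by (simp add: l2_norm_def)
qed

lemma l2_dominated:
  assumes "g \<in> l2 M" "f \<in> borel_measurable M" "AE x in M. cmod (f x) \<le> cmod (g x)"
  shows l2_of_dominated: "f \<in> l2 M" and l2_norm_mono: "l2_norm M f \<le> l2_norm M g"
proof -
  have le: "AE x in M. (cmod (f x))\<^sup>2 \<le> (cmod (g x))\<^sup>2"
    using assms(3) by (auto elim: eventually_mono)
  have i: "integrable M (\<lambda>x. (cmod (f x))\<^sup>2)"
    by (rule Bochner_Integration.integrable_bound[OF l2_integrable[OF assms(1)]])
       (use le assms(2) in \<open>auto elim: eventually_mono\<close>)
  then show "f \<in> l2 M"
    using assms(2) by (simp add: l2_def)
  show "l2_norm M f \<le> l2_norm M g"
    unfolding l2_norm_def
    by (intro real_sqrt_le_mono integral_mono_AE i l2_integrable assms le)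
qed

lemma l2_scale:
  assumes "f \<in> l2 M"
  shows "(\<lambda>x. c * f x) \<in> l2 M" and "l2_norm M (\<lambda>x. c * f x) = cmod c * l2_norm M f"
  using assms by (auto simp: l2_def l2_norm_def norm_mult power_mult_distrib real_sqrt_mult)

text \<open>The inequality \<open>2 a b \<le> s a\<^sup>2 + b\<^sup>2 / s\<close>, integrated and optimised over \<open>s\<close>; the
  summand \<open>e\<close> avoids a separate treatment of functions of norm zero.\<close>

lemma l2_Cauchy_Schwarz:
  assumes f: "f \<in> l2 M" and g: "g \<in> l2 M"
  shows l2_mult_integrable: "integrable M (\<lambda>x. f x * g x)"
    and l2_mult_integral_le: "(\<integral>x. cmod (f x) * cmod (g x) \<partial>M) \<le> l2_norm M f * l2_norm M g"
proof -
  note [measurable] = l2_measurable[OF f] l2_measurable[OF g]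
  note i = l2_integrable[OF f] l2_integrable[OF g]
  have amgm: "2 * (u * v) \<le> s * u\<^sup>2 + v\<^sup>2 / s" if "s > 0" for u v s :: real
  proof -
    have "0 \<le> (s * u - v)\<^sup>2 / s" using that by simp
    also have "\<dots> = s * u\<^sup>2 + v\<^sup>2 / s - 2 * (u * v)"
      using that by (simp add: field_simps power2_eq_square)
    finally show ?thesis by simp
  qed
  have i2: "integrable M (\<lambda>x. cmod (f x) * cmod (g x))"
  proof (rule Bochner_Integration.integrable_bound[OF Bochner_Integration.integrable_add[OF i]])
    show "AE x in M. norm (cmod (f x) * cmod (g x)) \<le> norm ((cmod (f x))\<^sup>2 + (cmod (g x))\<^sup>2)"
    proof (rule AE_I2)
      fix x
      have "2 * (cmod (f x) * cmod (g x)) \<le> (cmod (f x))\<^sup>2 + (cmod (g x))\<^sup>2"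
        using amgm[of 1] by simp
      moreover have "0 \<le> cmod (f x) * cmod (g x)" by simp
      ultimately have "cmod (f x) * cmod (g x) \<le> (cmod (f x))\<^sup>2 + (cmod (g x))\<^sup>2"
        by linarith
      then show "norm (cmod (f x) * cmod (g x)) \<le> norm ((cmod (f x))\<^sup>2 + (cmod (g x))\<^sup>2)"
        by (simp add: norm_mult)
    qed
  qed simp
  then show "integrable M (\<lambda>x. f x * g x)"
    using integrable_norm_iff[of "\<lambda>x. f x * g x" M] by (simp add: norm_mult)
  let ?a = "l2_norm M f" and ?b = "l2_norm M g"
  have le: "(\<integral>x. cmod (f x) * cmod (g x) \<partial>M) \<le> (?a + e) * (?b + e)" if e: "e > 0" for e
  proof -
    have pos: "?a + e > 0" "?b + e > 0" using e l2_norm_nonneg[of M f] l2_norm_nonneg[of M g] by linarith+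
    define s where "s = (?b + e) / (?a + e)"
    have s: "s > 0" using pos by (simp add: s_def)
    have "2 * (\<integral>x. cmod (f x) * cmod (g x) \<partial>M) = (\<integral>x. 2 * (cmod (f x) * cmod (g x)) \<partial>M)"
      by simp
    also have "\<dots> \<le> (\<integral>x. s * (cmod (f x))\<^sup>2 + (cmod (g x))\<^sup>2 / s \<partial>M)"
      by (rule integral_mono) (use i i2 amgm[OF s] in auto)
    also have "\<dots> = s * ?a\<^sup>2 + ?b\<^sup>2 / s"
      using i by (simp add: l2_norm_squared)
    also have "s * ?a\<^sup>2 \<le> s * (?a + e)\<^sup>2"
      using s e by (intro mult_left_mono power_mono) (auto simp: l2_norm_nonneg)
    also have "?b\<^sup>2 / s \<le> (?b + e)\<^sup>2 / s"
      using s e by (intro divide_right_mono power_mono) (auto simp: l2_norm_nonneg)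
    also have "s * (?a + e)\<^sup>2 = (?a + e) * (?b + e)"
      using pos by (simp add: s_def power2_eq_square)
    also have "(?b + e)\<^sup>2 / s = (?a + e) * (?b + e)"
      using pos by (simp add: s_def power2_eq_square)
    finally show ?thesis by simp
  qed
  have "((\<lambda>e. (?a + e) * (?b + e)) \<longlongrightarrow> (?a + 0) * (?b + 0)) (at_right 0)"
    by (intro tendsto_intros)
  then have "(\<integral>x. cmod (f x) * cmod (g x) \<partial>M) \<le> (?a + 0) * (?b + 0)"
    by (rule tendsto_lowerbound) (use le in \<open>auto simp: eventually_at_filter\<close>)
  then show "(\<integral>x. cmod (f x) * cmod (g x) \<partial>M) \<le> ?a * ?b" by simp
qed

lemma l2_add_norm:
  assumes f: "f \<in> l2 M" and g: "g \<in> l2 M"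
  shows l2_add: "(\<lambda>x. f x + g x) \<in> l2 M"
    and l2_norm_triangle: "l2_norm M (\<lambda>x. f x + g x) \<le> l2_norm M f + l2_norm M g"
proof -
  note [measurable] = l2_measurable[OF f] l2_measurable[OF g]
  note i = l2_integrable[OF f] l2_integrable[OF g]
  let ?r = "\<lambda>x. (cmod (f x))\<^sup>2 + 2 * (cmod (f x) * cmod (g x)) + (cmod (g x))\<^sup>2"
  have "integrable M (\<lambda>x. cmod (f x) * cmod (g x))"
    using integrable_norm[OF l2_mult_integrable[OF f g]] by (simp add: norm_mult)
  with i have ir: "integrable M ?r" by simp
  have le: "(cmod (f x + g x))\<^sup>2 \<le> ?r x" for x
    using power_mono[OF norm_triangle_ineq norm_ge_zero, of "f x" "g x" 2]
    by (simp add: power2_sum)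
  have il: "integrable M (\<lambda>x. (cmod (f x + g x))\<^sup>2)"
    by (rule Bochner_Integration.integrable_bound[OF ir])
       (use le in \<open>auto intro!: AE_I2 order_trans[OF _ abs_ge_self]\<close>)
  then show "(\<lambda>x. f x + g x) \<in> l2 M"
    by (simp add: l2_def)
  have "(l2_norm M (\<lambda>x. f x + g x))\<^sup>2 \<le> (\<integral>x. ?r x \<partial>M)"
    unfolding l2_norm_squared by (rule integral_mono[OF il ir le])
  also have "\<dots> = (l2_norm M f)\<^sup>2 + 2 * (\<integral>x. cmod (f x) * cmod (g x) \<partial>M) + (l2_norm M g)\<^sup>2"
    using i \<open>integrable M (\<lambda>x. cmod (f x) * cmod (g x))\<close> by (simp add: l2_norm_squared)
  also have "\<dots> \<le> (l2_norm M f + l2_norm M g)\<^sup>2"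
    using l2_mult_integral_le[OF f g] by (simp add: power2_sum)
  finally show "l2_norm M (\<lambda>x. f x + g x) \<le> l2_norm M f + l2_norm M g"
    by (rule power2_le_imp_le) (simp add: l2_norm_nonneg)
qed

lemma l2_diff: "f \<in> l2 M \<Longrightarrow> g \<in> l2 M \<Longrightarrow> (\<lambda>x. f x - g x) \<in> l2 M"
  using l2_add[of f M "\<lambda>x. - 1 * g x"] l2_scale(1)[of g M "- 1"] by simp

lemma l2_norm_triangle_diff:
  assumes "f \<in> l2 M" "g \<in> l2 M" "h \<in> l2 M"
  shows "l2_norm M (\<lambda>x. f x - h x) \<le> l2_norm M (\<lambda>x. f x - g x) + l2_norm M (\<lambda>x. g x - h x)"
  using l2_norm_triangle[OF l2_diff[OF assms(1,2)] l2_diff[OF assms(2,3)]] by simp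

lemma l2_sum:
  assumes "\<And>i. i \<in> I \<Longrightarrow> F i \<in> l2 M"
  shows "(\<lambda>x. \<Sum>i\<in>I. F i x) \<in> l2 M"
    and "l2_norm M (\<lambda>x. \<Sum>i\<in>I. F i x) \<le> (\<Sum>i\<in>I. l2_norm M (F i))"
proof -
  have zero: "(\<lambda>x. 0) \<in> l2 M" "l2_norm M (\<lambda>x. 0) = 0"
    by (auto simp: l2_def l2_norm_def)
  have "(\<lambda>x. \<Sum>i\<in>I. F i x) \<in> l2 M \<and> l2_norm M (\<lambda>x. \<Sum>i\<in>I. F i x) \<le> (\<Sum>i\<in>I. l2_norm M (F i))"
    using assms
  proof (induction I rule: infinite_finite_induct)
    case (insert i I)
    then have "F i \<in> l2 M" and IH: "(\<lambda>x. \<Sum>i\<in>I. F i x) \<in> l2 M"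
        "l2_norm M (\<lambda>x. \<Sum>i\<in>I. F i x) \<le> (\<Sum>i\<in>I. l2_norm M (F i))"
      by auto
    then show ?case
      using l2_add[of "F i" M "\<lambda>x. \<Sum>i\<in>I. F i x"] l2_norm_triangle[of "F i" M "\<lambda>x. \<Sum>i\<in>I. F i x"] insert.hyps
      by simp
  qed (auto simp: zero)
  then show "(\<lambda>x. \<Sum>i\<in>I. F i x) \<in> l2 M"
    and "l2_norm M (\<lambda>x. \<Sum>i\<in>I. F i x) \<le> (\<Sum>i\<in>I. l2_norm M (F i))" by auto
qed

lemma l2_dominated_convergence:
  assumes g: "g \<in> l2 M" and [measurable]: "\<And>n. F n \<in> borel_measurable M"
    and lim: "AE x in M. (\<lambda>n. F n x) \<longlonglongrightarrow> 0"
    and bound: "\<And>n. AE x in M. cmod (F n x) \<le> cmod (g x)"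
  shows "(\<lambda>n. l2_norm M (F n)) \<longlonglongrightarrow> 0"
proof -
  have "(\<lambda>n. \<integral>x. (cmod (F n x))\<^sup>2 \<partial>M) \<longlonglongrightarrow> (\<integral>x. 0 \<partial>M)"
  proof (rule integral_dominated_convergence[where w="\<lambda>x. (cmod (g x))\<^sup>2"])
    show "AE x in M. (\<lambda>n. (cmod (F n x))\<^sup>2) \<longlonglongrightarrow> 0"
      using lim
    proof eventually_elim
      case (elim x)
      have "(\<lambda>n. (cmod (F n x))\<^sup>2) \<longlonglongrightarrow> (cmod 0)\<^sup>2"
        by (intro tendsto_intros elim)
      then show ?case by simp
    qed
    show "AE x in M. norm ((cmod (F n x))\<^sup>2) \<le> (cmod (g x))\<^sup>2" for n
      using bound[of n] by (auto elim: eventually_mono)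
  qed (use l2_integrable[OF g] in auto)
  then have "(\<lambda>n. sqrt (\<integral>x. (cmod (F n x))\<^sup>2 \<partial>M)) \<longlonglongrightarrow> sqrt 0"
    by (intro tendsto_intros) simp
  then show ?thesis by (simp add: l2_norm_def)
qed

text \<open>Norm convergence yields almost everywhere convergence along a subsequence, which has to agree with
  any pointwise limit of the whole sequence.\<close>

lemma l2_limit_unique_AE:
  assumes v: "\<And>n. v n \<in> l2 M" and g: "g \<in> l2 M"
    and lim: "(\<lambda>n. l2_norm M (\<lambda>x. v n x - g x)) \<longlonglongrightarrow> 0"
    and pt: "AE x in M. (\<lambda>n. v n x) \<longlonglongrightarrow> h x"
  shows "AE x in M. g x = h x"
proof -
  have "(\<lambda>n. (l2_norm M (\<lambda>x. v n x - g x))\<^sup>2) \<longlonglongrightarrow> 0\<^sup>2"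
    by (intro tendsto_intros lim)
  then have "(\<lambda>n. \<integral>x. norm ((cmod (v n x - g x))\<^sup>2) \<partial>M) \<longlonglongrightarrow> 0"
    by (simp add: l2_norm_squared)
  then obtain r where r: "strict_mono r" "AE x in M. (\<lambda>n. (cmod (v (r n) x - g x))\<^sup>2) \<longlonglongrightarrow> 0"
    using tendsto_L1_AE_subseq[of M "\<lambda>n x. (cmod (v n x - g x))\<^sup>2"] l2_integrable[OF l2_diff[OF v g]]
    by blast
  show ?thesis
    using r(2) pt
  proof eventually_elim
    case (elim x)
    have "(\<lambda>n. sqrt ((cmod (v (r n) x - g x))\<^sup>2)) \<longlonglongrightarrow> sqrt 0"
      by (intro tendsto_intros elim)
    then have "(\<lambda>n. v (r n) x - g x) \<longlonglongrightarrow> 0"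
      by (simp add: tendsto_norm_zero_iff)
    then have "(\<lambda>n. v (r n) x) \<longlonglongrightarrow> g x"
      by (simp add: LIM_zero_iff)
    moreover have "(\<lambda>n. v (r n) x) \<longlonglongrightarrow> h x"
      using LIMSEQ_subseq_LIMSEQ[OF elim(2) r(1)] by (simp add: o_def)
    ultimately show ?case by (rule LIMSEQ_unique)
  qed
qed

lemma l2_closureI:
  assumes "f \<in> l2 N" "g \<in> l2 M" "\<And>n. (u n, v n) \<in> G"
    and "(\<lambda>n. l2_norm N (\<lambda>x. u n x - f x)) \<longlonglongrightarrow> 0" "(\<lambda>n. l2_norm M (\<lambda>y. v n y - g y)) \<longlonglongrightarrow> 0"
  shows "(f, g) \<in> l2_closure N M G"
  using assms unfolding l2_closure_def by blast

text \<open>The sequence in the definition of the closure is replaced by an \<open>e\<close>-approximation, which makes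
  diagonal arguments unnecessary.\<close>

lemma l2_closure_iff:
  "(f, g) \<in> l2_closure N M G \<longleftrightarrow> f \<in> l2 N \<and> g \<in> l2 M \<and>
     (\<forall>e>0. \<exists>(u, v)\<in>G. l2_norm N (\<lambda>x. u x - f x) < e \<and> l2_norm M (\<lambda>y. v y - g y) < e)"
  (is "?L \<longleftrightarrow> ?f \<and> ?g \<and> ?R")
proof
  assume ?L
  then obtain u v where fg: ?f ?g and uv: "\<And>n. (u n, v n) \<in> G"
    and lim: "(\<lambda>n. l2_norm N (\<lambda>x. u n x - f x)) \<longlonglongrightarrow> 0" "(\<lambda>n. l2_norm M (\<lambda>y. v n y - g y)) \<longlonglongrightarrow> 0"
    unfolding l2_closure_def by auto
  have ?R
  proof (intro allI impI)
    fix e :: real assume "e > 0"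
    with lim have "\<forall>\<^sub>F n in sequentially. l2_norm N (\<lambda>x. u n x - f x) < e \<and> l2_norm M (\<lambda>y. v n y - g y) < e"
      by (intro eventually_conj order_tendstoD(2)) auto
    then obtain n where "l2_norm N (\<lambda>x. u n x - f x) < e" "l2_norm M (\<lambda>y. v n y - g y) < e"
      by (auto simp: eventually_sequentially)
    with uv[of n] show "\<exists>(u, v)\<in>G. l2_norm N (\<lambda>x. u x - f x) < e \<and> l2_norm M (\<lambda>y. v y - g y) < e"
      by blast
  qed
  with fg show "?f \<and> ?g \<and> ?R" by blast
next
  assume A: "?f \<and> ?g \<and> ?R"
  then have "\<exists>p\<in>G. l2_norm N (\<lambda>x. fst p x - f x) < 1 / real (Suc n) \<and> l2_norm M (\<lambda>y. snd p y - g y) < 1 / real (Suc n)"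
    for n
  proof -
    have "1 / real (Suc n) > 0" by simp
    with A obtain u v where "(u, v) \<in> G" "l2_norm N (\<lambda>x. u x - f x) < 1 / real (Suc n)"
      "l2_norm M (\<lambda>y. v y - g y) < 1 / real (Suc n)"
      by blast
    then show ?thesis by (intro bexI[of _ "(u, v)"]) auto
  qed
  then obtain p where p: "\<And>n. p n \<in> G" "\<And>n. l2_norm N (\<lambda>x. fst (p n) x - f x) < 1 / real (Suc n)"
      "\<And>n. l2_norm M (\<lambda>y. snd (p n) y - g y) < 1 / real (Suc n)"
    by metis
  have inv: "(\<lambda>n. 1 / real (Suc n)) \<longlonglongrightarrow> 0"
    using LIMSEQ_inverse_real_of_nat by (simp add: inverse_eq_divide)
  have "(\<lambda>n. l2_norm N (\<lambda>x. fst (p n) x - f x)) \<longlonglongrightarrow> 0"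
    by (rule tendsto_sandwich[OF _ _ tendsto_const inv])
       (auto simp: l2_norm_nonneg p less_imp_le simp del: of_nat_Suc)
  moreover have "(\<lambda>n. l2_norm M (\<lambda>y. snd (p n) y - g y)) \<longlonglongrightarrow> 0"
    by (rule tendsto_sandwich[OF _ _ tendsto_const inv])
       (auto simp: l2_norm_nonneg p less_imp_le simp del: of_nat_Suc)
  ultimately show ?L
    using A p(1) by (intro l2_closureI[of _ _ _ _ "\<lambda>n. fst (p n)" "\<lambda>n. snd (p n)"]) auto
qed

lemma l2_closure_mono: "G \<subseteq> H \<Longrightarrow> l2_closure N M G \<subseteq> l2_closure N M H"
  unfolding l2_closure_def by blast

lemma l2_closure_idem:
  assumes G: "G \<subseteq> l2 N \<times> l2 M"
  shows "l2_closure N M (l2_closure N M G) \<subseteq> l2_closure N M G"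
proof clarify
  fix f g assume fg: "(f, g) \<in> l2_closure N M (l2_closure N M G)"
  then have l2: "f \<in> l2 N" "g \<in> l2 M" by (auto simp: l2_closure_iff)
  show "(f, g) \<in> l2_closure N M G"
    unfolding l2_closure_iff[of f g]
  proof (intro conjI allI impI l2)
    fix e :: real assume "e > 0"
    then have e2: "e / 2 > 0" by simp
    obtain u v where uv: "(u, v) \<in> l2_closure N M G"
      "l2_norm N (\<lambda>x. u x - f x) < e / 2" "l2_norm M (\<lambda>y. v y - g y) < e / 2"
      using fg e2 unfolding l2_closure_iff[of f g] by blast
    obtain p q where pq: "(p, q) \<in> G"
      "l2_norm N (\<lambda>x. p x - u x) < e / 2" "l2_norm M (\<lambda>y. q y - v y) < e / 2"
      using uv(1) e2 unfolding l2_closure_iff[of u v] by blast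
    have "u \<in> l2 N" "v \<in> l2 M" using uv(1) by (auto simp: l2_closure_iff)
    moreover have "p \<in> l2 N" "q \<in> l2 M" using pq(1) G by auto
    ultimately have "l2_norm N (\<lambda>x. p x - f x) < e" "l2_norm M (\<lambda>y. q y - g y) < e"
      using l2_norm_triangle_diff[of p N u f] l2_norm_triangle_diff[of q M v g] uv(2,3) pq(2,3) l2
      by auto
    with pq(1) show "\<exists>(u, v)\<in>G. l2_norm N (\<lambda>x. u x - f x) < e \<and> l2_norm M (\<lambda>y. v y - g y) < e"
      by blast
  qed
qed

lemma l2_graph_subset: "l2_graph N M D T \<subseteq> l2 N \<times> l2 M"
  by (auto simp: l2_graph_def)

section \<open>Density of smooth compactly supported functions\<close>

text \<open>The bump \<open>exp (- 1 / w)\<close> with \<open>w t = (t - c) * (d - t)\<close>, divided by a power of \<open>w\<close> and multiplied by a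
  polynomial \<open>q\<close>.  Powers of \<open>w\<close> in the denominator are included because the family is then closed under
  differentiation, which reduces smoothness to a single derivative computation.\<close>

definition bump_poly :: "real \<Rightarrow> real \<Rightarrow> nat \<Rightarrow> (real \<Rightarrow> complex) \<Rightarrow> real \<Rightarrow> complex" where
  "bump_poly c d m q t =
     (if c < t \<and> t < d then (exp (- 1 / ((t - c) * (d - t))) / ((t - c) * (d - t)) ^ m) *\<^sub>R q t else 0)"

lemma power_div_fact_le_exp:
  fixes y :: real
  assumes "0 \<le> y"
  shows "y ^ n / fact n \<le> exp y"
proof -
  have s: "(\<lambda>k. y ^ k /\<^sub>R fact k) sums exp y" by (rule exp_converges)
  have "(\<Sum>k\<in>{n}. y ^ k /\<^sub>R fact k) \<le> exp y"
    unfolding sums_unique[OF s]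
    by (rule sum_le_suminf[OF sums_summable[OF s]]) (use assms in auto)
  then show ?thesis by (simp add: divide_inverse mult.commute)
qed

text \<open>The exponential dominates every pole, which leaves a double zero at both end points.\<close>

lemma bump_poly_double_zero:
  assumes "c < d" and q: "continuous_on UNIV q" and e: "e = c \<or> e = d"
  obtains B where "B \<ge> 0" "\<And>t. cmod (bump_poly c d m q t) \<le> B * (t - e)\<^sup>2"
proof -
  obtain Q where Q: "\<And>t. t \<in> {c..d} \<Longrightarrow> cmod (q t) \<le> Q"
    using compact_imp_bounded[OF compact_continuous_image[OF continuous_on_subset[OF q subset_UNIV] compact_Icc]]
    unfolding bounded_iff by blast
  have Q0: "Q \<ge> 0" using Q[of c] \<open>c < d\<close> norm_ge_zero[of "q c"] by (simp del: norm_ge_zero)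
  define B where "B = fact (m + 2) * (d - c)\<^sup>2 * Q"
  have "cmod (bump_poly c d m q t) \<le> B * (t - e)\<^sup>2" for t
  proof (cases "c < t \<and> t < d")
    case True
    define w where "w = (t - c) * (d - t)"
    have w: "w > 0" using True by (simp add: w_def)
    have "(1 / w) ^ (m + 2) / fact (m + 2) \<le> exp (1 / w)"
      using w by (intro power_div_fact_le_exp) simp
    then have "1 / exp (1 / w) \<le> 1 / ((1 / w) ^ (m + 2) / fact (m + 2))"
      using w by (intro divide_left_mono) auto
    then have "exp (- 1 / w) \<le> fact (m + 2) * w ^ (m + 2)"
      by (simp add: exp_minus power_one_over field_simps)
    then have "exp (- 1 / w) / w ^ m \<le> fact (m + 2) * w ^ (m + 2) / w ^ m"
      using w by (intro divide_right_mono) auto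
    also have "\<dots> = fact (m + 2) * w\<^sup>2"
      using w by (simp add: power_add power2_eq_square)
    also have "w\<^sup>2 \<le> (d - c)\<^sup>2 * (t - e)\<^sup>2"
    proof -
      have "w \<le> (d - c) * \<bar>t - e\<bar>"
      proof (cases "e = c")
        case True
        then show ?thesis
          using \<open>c < t \<and> t < d\<close> mult_mono[of "t - c" "t - c" "d - t" "d - c"]
          by (simp add: w_def mult.commute)
      next
        case False
        then show ?thesis
          using e \<open>c < t \<and> t < d\<close> mult_mono[of "t - c" "d - c" "d - t" "d - t"]
          by (simp add: w_def)
      qed
      then have "w\<^sup>2 \<le> ((d - c) * \<bar>t - e\<bar>)\<^sup>2" using w by (intro power_mono) auto
      then show ?thesis by (simp add: power_mult_distrib)
    qed
    finally have "exp (- 1 / w) / w ^ m \<le> fact (m + 2) * ((d - c)\<^sup>2 * (t - e)\<^sup>2)" by simp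
    moreover have "cmod (q t) \<le> Q" using Q[of t] True by simp
    ultimately have "exp (- 1 / w) / w ^ m * cmod (q t) \<le> fact (m + 2) * ((d - c)\<^sup>2 * (t - e)\<^sup>2) * Q"
      using w by (intro mult_mono) auto
    moreover have "bump_poly c d m q t = (exp (- 1 / w) / w ^ m) *\<^sub>R q t"
      using True by (simp add: bump_poly_def w_def)
    ultimately show ?thesis
      using w by (simp add: B_def ac_simps)
  qed (auto simp: bump_poly_def B_def Q0)
  moreover have "B \<ge> 0" by (simp add: B_def Q0)
  ultimately show ?thesis using that by blast
qed

lemma has_vector_derivative_zero_of_double_zero:
  fixes f :: "real \<Rightarrow> complex"
  assumes B: "B \<ge> 0" "\<And>t. cmod (f t) \<le> B * (t - e)\<^sup>2"
  shows "(f has_vector_derivative 0) (at e)"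
  unfolding has_vector_derivative_def scaleR_zero_right
proof (rule has_derivativeI_sandwich[where e=1 and H="\<lambda>y. B * \<bar>y - e\<bar>"])
  fix y assume y: "y \<noteq> e"
  have "f e = 0" using B(2)[of e] by simp
  then show "norm ((f y - f e) - 0) / norm (y - e) \<le> B * \<bar>y - e\<bar>"
    using B(2)[of y] y by (simp add: divide_le_eq power2_eq_square abs_mult_self_eq mult.assoc)
next
  have "((\<lambda>y. B * \<bar>y - e\<bar>) \<longlongrightarrow> B * \<bar>e - e\<bar>) (at e)"
    by (intro tendsto_intros)
  then show "((\<lambda>y. B * \<bar>y - e\<bar>) \<longlongrightarrow> 0) (at e)" by simp
qed auto

lemma bump_poly_derivative:
  assumes cd: "c < d" and q: "polynomial_function q"
  obtains q' where "polynomial_function q'"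
    "\<And>t. (bump_poly c d m q has_vector_derivative bump_poly c d (m + 2) q' t) (at t)"
proof -
  obtain q1 where q1: "polynomial_function q1" "\<And>t. (q has_vector_derivative q1 t) (at t)"
    using has_vector_derivative_polynomial_function[OF q] by blast
  define w where "w t = (t - c) * (d - t)" for t
  define w' where "w' t = c + d - 2 * t" for t
  have pw: "polynomial_function w" "polynomial_function w'"
  proof -
    have "polynomial_function (\<lambda>t. (t - c) *\<^sub>R (d - t))" "polynomial_function (\<lambda>t. (c + d) - 2 *\<^sub>R t)"
      by (intro polynomial_function_mult polynomial_function_diff polynomial_function_const
          polynomial_function_id polynomial_function_cmul)+
    then show "polynomial_function w" "polynomial_function w'"
      by (simp_all add: w_def[abs_def] w'_def[abs_def])
  qed
  define q' where "q' t = (w t *\<^sub>R w t) *\<^sub>R q1 t + ((1 - real m *\<^sub>R w t) *\<^sub>R w' t) *\<^sub>R q t" for t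
  have pq': "polynomial_function q'"
    unfolding q'_def[abs_def]
    by (intro polynomial_function_add polynomial_function_mult polynomial_function_diff polynomial_function_const
        polynomial_function_cmul pw q q1)
  have "(bump_poly c d m q has_vector_derivative bump_poly c d (m + 2) q' t) (at t)" for t
  proof -
    consider "c < t \<and> t < d" | "t < c \<or> d < t" | "t = c \<or> t = d" by fastforce
    then show ?thesis
    proof cases
      case 1
      then have w: "w t > 0" by (simp add: w_def)
      have dw: "(w has_field_derivative w' t) (at t)"
        unfolding w_def[abs_def] w'_def by (auto intro!: derivative_eq_intros)
      let ?r = "\<lambda>t. exp (- 1 / w t) / w t ^ m"
      have "(?r has_field_derivative
          ((w' t / (w t)\<^sup>2 * exp (- 1 / w t)) * w t ^ m - exp (- 1 / w t) * (real m * (w' t * w t ^ (m - 1))))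
            / (w t ^ m * w t ^ m)) (at t)"
        using w by (auto intro!: derivative_eq_intros dw simp: power2_eq_square)
      also have "((w' t / (w t)\<^sup>2 * exp (- 1 / w t)) * w t ^ m - exp (- 1 / w t) * (real m * (w' t * w t ^ (m - 1))))
            / (w t ^ m * w t ^ m)
          = exp (- 1 / w t) / w t ^ (m + 2) * ((1 - real m * w t) * w' t)"
        using w by (cases m) (auto simp: field_simps power2_eq_square)
      finally have dr: "(?r has_vector_derivative exp (- 1 / w t) / w t ^ (m + 2) * ((1 - real m * w t) * w' t)) (at t)"
        by (simp add: has_real_derivative_iff_has_vector_derivative)
      have "((\<lambda>t. ?r t *\<^sub>R q t) has_vector_derivative
          (?r t *\<^sub>R q1 t + (exp (- 1 / w t) / w t ^ (m + 2) * ((1 - real m * w t) * w' t)) *\<^sub>R q t)) (at t)"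
        by (rule has_vector_derivative_scaleR[OF _ q1(2)])
           (use dr in \<open>simp add: has_real_derivative_iff_has_vector_derivative\<close>)
      also have "?r t *\<^sub>R q1 t + (exp (- 1 / w t) / w t ^ (m + 2) * ((1 - real m * w t) * w' t)) *\<^sub>R q t
          = (exp (- 1 / w t) / w t ^ (m + 2)) *\<^sub>R q' t"
        using w by (simp add: q'_def scaleR_add_right power_add power2_eq_square)
      finally have "((\<lambda>t. ?r t *\<^sub>R q t) has_vector_derivative bump_poly c d (m + 2) q' t) (at t)"
        using 1 by (simp add: bump_poly_def w_def)
      then show ?thesis
        by (rule has_vector_derivative_transform_within_open[where S="{c<..<d}"])
           (use 1 in \<open>auto simp: bump_poly_def w_def\<close>)
    next
      case 2
      have "((\<lambda>t. 0) has_vector_derivative bump_poly c d (m + 2) q' t) (at t)"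
        using 2 by (auto simp: bump_poly_def)
      then show ?thesis
        by (rule has_vector_derivative_transform_within_open[where S="- {c..d}"])
           (use 2 in \<open>auto simp: bump_poly_def open_Compl\<close>)
    next
      case 3
      have "continuous_on UNIV q" by (rule continuous_on_polymonial_function[OF q])
      from bump_poly_double_zero[OF cd this 3, of m] obtain B
        where "B \<ge> 0" "\<And>s. cmod (bump_poly c d m q s) \<le> B * (s - t)\<^sup>2" by blast
      then have "(bump_poly c d m q has_vector_derivative 0) (at t)"
        by (rule has_vector_derivative_zero_of_double_zero)
      then show ?thesis using 3 by (auto simp: bump_poly_def)
    qed
  qed
  with pq' that show ?thesis by blast
qed

lemma bump_poly_in_C0_inf_plus:
  assumes c: "0 < c" "c < d" and q: "polynomial_function q"
  shows "bump_poly c d m q \<in> C0_inf_plus"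
proof -
  have iter: "\<exists>k p. polynomial_function p \<and>
      ((\<lambda>g t. vector_derivative g (at t)) ^^ n) (bump_poly c d m q) = bump_poly c d k p" for n
  proof (induction n)
    case 0
    then show ?case using q by auto
  next
    case (Suc n)
    then obtain k p where p: "polynomial_function p"
      "((\<lambda>g t. vector_derivative g (at t)) ^^ n) (bump_poly c d m q) = bump_poly c d k p" by blast
    obtain p' where p': "polynomial_function p'"
      "\<And>t. (bump_poly c d k p has_vector_derivative bump_poly c d (k + 2) p' t) (at t)"
      using bump_poly_derivative[OF c(2) p(1)] by blast
    have "((\<lambda>g t. vector_derivative g (at t)) ^^ Suc n) (bump_poly c d m q) = bump_poly c d (k + 2) p'"
      using p(2) p'(2) by (auto intro!: vector_derivative_at)
    with p'(1) show ?case by blast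
  qed
  have "((\<lambda>g t. vector_derivative g (at t)) ^^ n) (bump_poly c d m q) differentiable_on {0<..}" for n
  proof -
    obtain k p where p: "polynomial_function p"
      "((\<lambda>g t. vector_derivative g (at t)) ^^ n) (bump_poly c d m q) = bump_poly c d k p"
      using iter by blast
    have "bump_poly c d k p differentiable (at t)" for t
      using bump_poly_derivative[OF c(2) p(1), of k] differentiableI_vector by metis
    then show ?thesis
      unfolding p(2) differentiable_on_def by (auto intro: differentiable_at_withinI)
  qed
  moreover have "compact {c..d}" "{c..d} \<subseteq> {0<..}" "\<forall>t\<in>{0<..} - {c..d}. bump_poly c d m q t = 0"
    using c by (auto simp: bump_poly_def)
  ultimately show ?thesis unfolding C0_inf_plus_def by blast
qed

lemma borel_measurable_R_plus: "f \<in> borel_measurable borel \<Longrightarrow> f \<in> borel_measurable R_plus"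
  by (rule measurable_restrict_space1) simp

lemma borel_measurable_R_plus_iff:
  fixes f :: "real \<Rightarrow> complex"
  shows "f \<in> borel_measurable R_plus \<longleftrightarrow> (\<lambda>t. indicator {0<..} t *\<^sub>R f t) \<in> borel_measurable borel"
  by (subst borel_measurable_restrict_space_iff) auto

lemma AE_R_plus_of_lborel: "AE t in lborel. P t \<Longrightarrow> AE t in R_plus. P t"
  by (subst AE_restrict_space_iff) (auto elim: eventually_mono)

lemma indicator_Icc_l2:
  assumes "0 < c" "c \<le> d"
  shows "(\<lambda>t. of_real (indicator {c..d} t)) \<in> l2 R_plus"
    and "l2_norm R_plus (\<lambda>t. of_real (indicator {c..d} t)) = sqrt (d - c)"
proof -
  have eq: "(\<lambda>t. indicator {0<..} t *\<^sub>R (cmod (of_real (indicator {c..d} t)))\<^sup>2) = (indicator {c..d} :: real \<Rightarrow> real)"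
    using assms by (auto simp: indicator_def)
  have "(\<lambda>t. complex_of_real (indicator {c..d} t)) \<in> borel_measurable R_plus"
    by (rule borel_measurable_R_plus) measurable
  moreover have "integrable R_plus (\<lambda>t. (cmod (complex_of_real (indicator {c..d} t)))\<^sup>2)"
    by (subst integrable_restrict_space) (simp_all only: eq, auto simp: integrable_indicator_iff emeasure_lborel_Icc_eq)
  ultimately show "(\<lambda>t. of_real (indicator {c..d} t)) \<in> l2 R_plus" by (simp add: l2_def)
  have "(\<integral>t. (cmod (complex_of_real (indicator {c..d} t)))\<^sup>2 \<partial>R_plus) = (\<integral>t. indicator {c..d} t \<partial>lborel)"
    by (subst integral_restrict_space) (simp_all only: eq, auto)
  then show "l2_norm R_plus (\<lambda>t. of_real (indicator {c..d} t)) = sqrt (d - c)"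
    using assms by (simp add: l2_norm_def)
qed

text \<open>Lusin-type approximation; projection onto the disc of radius \<open>k\<close> restores the bound without
  destroying continuity or the limit.\<close>

lemma bounded_approx_by_continuous:
  assumes m: "g \<in> borel_measurable borel" and b: "\<And>t. cmod (g t) \<le> k"
  obtains H :: "nat \<Rightarrow> real \<Rightarrow> complex"
  where "\<And>n. continuous_on UNIV (H n)" "\<And>n t. cmod (H n t) \<le> k" "AE t in lborel. (\<lambda>n. H n t) \<longlonglongrightarrow> g t"
proof -
  have k: "k \<ge> 0" using b norm_ge_zero order_trans by blast
  have "g \<in> borel_measurable lebesgue"
    using measurable_completion[of g lborel borel] m by simp
  then have "g measurable_on UNIV"
    by (rule lebesgue_measurable_imp_measurable_on) simp
  then obtain N h where N: "negligible N" and h: "\<And>n::nat. continuous_on UNIV (h n)"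
    "\<And>t. t \<notin> N \<Longrightarrow> (\<lambda>n. h n t) \<longlonglongrightarrow> g t"
    unfolding measurable_on_def by auto
  let ?P = "closest_point (cball (0::complex) k)"
  have ne: "cball (0::complex) k \<noteq> {}" using k by simp
  have contP: "continuous_on UNIV ?P"
    using ne by (intro continuous_on_closest_point) auto
  show ?thesis
  proof (rule that[of "\<lambda>n t. ?P (h n t)"])
    show "continuous_on UNIV (\<lambda>t. ?P (h n t))" for n
      by (rule continuous_on_compose2[OF contP h(1)]) auto
    show "cmod (?P (h n t)) \<le> k" for n t
      using closest_point_in_set[OF closed_cball ne, of "h n t"] by simp
    have "AE t in lebesgue. t \<notin> N"
      using N by (intro AE_not_in) (simp add: negligible_iff_null_sets)
    then have "AE t in lborel. t \<notin> N" by (simp add: AE_completion_iff)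
    then show "AE t in lborel. (\<lambda>n. ?P (h n t)) \<longlonglongrightarrow> g t"
    proof eventually_elim
      case (elim t)
      have "isCont ?P (g t)"
        using contP by (simp add: continuous_on_eq_continuous_at)
      then have "(\<lambda>n. ?P (h n t)) \<longlonglongrightarrow> ?P (g t)"
        using h(2)[OF elim] by (rule isCont_tendsto_compose)
      moreover have "?P (g t) = g t" using b by (intro closest_point_self) simp
      ultimately show ?case by simp
    qed
  qed
qed

text \<open>The bump times a polynomial suffices.  On the support of \<open>f\<close> the bump is bounded below,
  so \<open>f\<close> is the bump times a square-integrable \<open>g\<close>; then \<open>g\<close> is approximated in turn by a bounded
  function, a continuous one and, by Weierstrass, a polynomial on \<open>{c..d}\<close>.  Multiplication by the bump,
  which is at most \<open>1\<close>, preserves the error.\<close>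

lemma smooth_approximation:
  assumes f: "f \<in> l2 R_plus" and supp: "\<And>t. t \<notin> {a..b} \<Longrightarrow> f t = 0"
    and ab: "0 < c" "c < a" "a \<le> b" "b < d" and e: "e > 0"
  obtains \<phi> where "\<phi> \<in> C0_inf_plus" "continuous_on UNIV \<phi>" "\<And>t. t \<notin> {c..d} \<Longrightarrow> \<phi> t = 0"
    "l2_norm R_plus (\<lambda>t. \<phi> t - f t) < e"
proof -
  define w where "w t = (t - c) * (d - t)" for t
  let ?J = "\<lambda>t. complex_of_real (indicator {c..d} t)"
  have J: "?J \<in> l2 R_plus" using indicator_Icc_l2(1)[of c d] ab by simp
  note mJ [measurable] = l2_measurable[OF J]
  define \<delta> where "\<delta> = (a - c) * (d - b)"
  have \<delta>: "\<delta> > 0" using ab by (simp add: \<delta>_def)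
  have w\<delta>: "\<delta> \<le> w t" if "t \<in> {a..b}" for t
    using that ab unfolding \<delta>_def w_def by (intro mult_mono) auto
  define g where "g t = (indicator {a..b} t * exp (1 / w t)) *\<^sub>R f t" for t
  have mf [measurable]: "f \<in> borel_measurable R_plus" by (rule l2_measurable[OF f])
  have [measurable]: "(\<lambda>t. indicator {a..b} t * exp (1 / w t)) \<in> borel_measurable R_plus"
    unfolding w_def by (rule borel_measurable_R_plus) measurable
  have mg [measurable]: "g \<in> borel_measurable R_plus"
    unfolding g_def by measurable
  have fg: "f t = exp (- 1 / w t) *\<^sub>R g t" for t
    using supp[of t] by (auto simp: g_def indicator_def exp_minus_inverse simp flip: exp_add)
  have g: "g \<in> l2 R_plus"
  proof (rule l2_of_dominated[OF l2_scale(1)[OF f, of "of_real (exp (1 / \<delta>))"] mg])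
    show "AE t in R_plus. cmod (g t) \<le> cmod (of_real (exp (1 / \<delta>)) * f t)"
    proof (rule AE_I2)
      fix t
      have "exp (1 / w t) \<le> exp (1 / \<delta>)" if "t \<in> {a..b}"
        using w\<delta>[OF that] \<delta> by (simp add: frac_le)
      then show "cmod (g t) \<le> cmod (of_real (exp (1 / \<delta>)) * f t)"
        by (auto simp: g_def norm_mult indicator_def intro!: mult_right_mono)
    qed
  qed
  define T where "T k t = (if cmod (g t) \<le> real k then g t else 0)" for k :: nat and t
  have mT [measurable]: "T k \<in> borel_measurable R_plus" for k
    unfolding T_def by measurable
  have Tl2: "T k \<in> l2 R_plus" for k
    by (rule l2_of_dominated[OF g]) (auto simp: T_def)
  have "(\<lambda>k. l2_norm R_plus (\<lambda>t. T k t - g t)) \<longlonglongrightarrow> 0"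
  proof (rule l2_dominated_convergence[OF g])
    show "AE t in R_plus. (\<lambda>k. T k t - g t) \<longlonglongrightarrow> 0"
    proof (rule AE_I2)
      fix t
      have "\<forall>\<^sub>F k in sequentially. T k t - g t = 0"
        using eventually_ge_at_top[of "nat \<lceil>cmod (g t)\<rceil>"]
        by eventually_elim (auto simp: T_def nat_ceiling_le_eq)
      then show "(\<lambda>k. T k t - g t) \<longlonglongrightarrow> 0" by (rule tendsto_eventually)
    qed
  qed (auto simp: T_def)
  then obtain k where k: "l2_norm R_plus (\<lambda>t. T k t - g t) < e / 3"
    using order_tendstoD(2)[of _ 0 sequentially "e / 3"] e by (auto simp: eventually_sequentially)
  define T' where "T' t = indicator {0<..} t *\<^sub>R T k t" for t
  have "T' \<in> borel_measurable borel"
    using mT[of k] unfolding T'_def by (simp add: borel_measurable_R_plus_iff)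
  moreover have "cmod (T' t) \<le> real k" for t
    by (auto simp: T'_def T_def indicator_def)
  ultimately obtain H where H: "\<And>n. continuous_on UNIV (H n)" "\<And>n t. cmod (H n t) \<le> real k"
    "AE t in lborel. (\<lambda>n. H n t) \<longlonglongrightarrow> T' t"
    using bounded_approx_by_continuous by blast
  have mH [measurable]: "H n \<in> borel_measurable R_plus" for n
    by (rule borel_measurable_R_plus[OF borel_measurable_continuous_onI[OF H(1)]])
  have JT: "?J t * T k t = T k t" for t
    using ab by (auto simp: T_def g_def indicator_def)
  have "(\<lambda>n. l2_norm R_plus (\<lambda>t. ?J t * H n t - T k t)) \<longlonglongrightarrow> 0"
  proof (rule l2_dominated_convergence[OF l2_scale(1)[OF J, of "of_real (2 * real k)"]])
    show "(\<lambda>t. ?J t * H n t - T k t) \<in> borel_measurable R_plus" for n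
      by measurable
    show "AE t in R_plus. (\<lambda>n. ?J t * H n t - T k t) \<longlonglongrightarrow> 0"
      using AE_R_plus_of_lborel[OF H(3)] AE_space[of R_plus]
    proof eventually_elim
      case (elim t)
      have "(\<lambda>n. ?J t * H n t - T k t) \<longlonglongrightarrow> ?J t * T' t - T k t"
        by (intro tendsto_intros elim)
      moreover have "T' t = T k t" using elim(2) by (simp add: T'_def space_restrict_space)
      ultimately show ?case using JT[of t] by simp
    qed
    show "AE t in R_plus. cmod (?J t * H n t - T k t) \<le> cmod (of_real (2 * real k) * ?J t)" for n
    proof (rule AE_I2)
      fix t
      have "cmod (H n t - T k t) \<le> 2 * real k"
        using norm_triangle_ineq4[of "H n t" "T k t"] H(2)[of n t] by (auto simp: T_def split: if_splits)
      moreover have "?J t * H n t - T k t = ?J t * (H n t - T k t)"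
        by (simp add: right_diff_distrib JT)
      ultimately show "cmod (?J t * H n t - T k t) \<le> cmod (of_real (2 * real k) * ?J t)"
        by (simp add: norm_mult indicator_def)
    qed
  qed
  then obtain n where n: "l2_norm R_plus (\<lambda>t. ?J t * H n t - T k t) < e / 3"
    using order_tendstoD(2)[of _ 0 sequentially "e / 3"] e by (auto simp: eventually_sequentially)
  define \<eta> where "\<eta> = e / 3 / (1 + l2_norm R_plus ?J)"
  have \<eta>: "\<eta> > 0" using e l2_norm_nonneg[of R_plus ?J] by (simp add: \<eta>_def)
  obtain p where p: "polynomial_function p" "\<And>t. t \<in> {c..d} \<Longrightarrow> cmod (H n t - p t) < \<eta>"
    using Stone_Weierstrass_polynomial_function[OF compact_Icc continuous_on_subset[OF H(1) subset_UNIV] \<eta>]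
    by metis
  have mp [measurable]: "p \<in> borel_measurable R_plus"
    by (rule borel_measurable_R_plus[OF borel_measurable_continuous_onI])
       (rule continuous_on_polymonial_function[OF p(1)])
  have bnd: "(\<lambda>t. ?J t * q t) \<in> l2 R_plus"
    if q: "q \<in> borel_measurable R_plus" "continuous_on UNIV q" for q
  proof -
    obtain Q where Q: "\<And>t. t \<in> {c..d} \<Longrightarrow> cmod (q t) \<le> Q"
      using compact_imp_bounded[OF compact_continuous_image[OF continuous_on_subset[OF q(2) subset_UNIV] compact_Icc]]
      unfolding bounded_iff by blast
    show ?thesis
    proof (rule l2_of_dominated[OF l2_scale(1)[OF J, of "of_real Q"]])
      show "AE t in R_plus. cmod (?J t * q t) \<le> cmod (of_real Q * ?J t)"
        using Q by (intro AE_I2) (force simp: norm_mult indicator_def)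
    qed (use q(1) in measurable)
  qed
  have Jp: "(\<lambda>t. ?J t * p t) \<in> l2 R_plus" and JH: "(\<lambda>t. ?J t * H n t) \<in> l2 R_plus"
    by (intro bnd mp mH H(1) continuous_on_polymonial_function[OF p(1)])+
  have "l2_norm R_plus (\<lambda>t. ?J t * p t - ?J t * H n t) \<le> l2_norm R_plus (\<lambda>t. of_real \<eta> * ?J t)"
  proof (rule l2_norm_mono[OF l2_scale(1)[OF J] l2_measurable[OF l2_diff[OF Jp JH]]], rule AE_I2)
    fix t
    show "cmod (?J t * p t - ?J t * H n t) \<le> cmod (of_real \<eta> * ?J t)"
      using p(2)[of t] \<eta> by (auto simp: norm_mult indicator_def norm_minus_commute)
  qed
  also have "\<dots> = \<eta> * l2_norm R_plus ?J" using \<eta> by (simp add: l2_scale(2)[OF J])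
  also have "\<dots> \<le> \<eta> * (1 + l2_norm R_plus ?J)" using \<eta> by simp
  also have "\<dots> = e / 3"
  proof -
    have "1 + l2_norm R_plus ?J \<noteq> 0" using l2_norm_nonneg[of R_plus ?J] by linarith
    then show ?thesis unfolding \<eta>_def by (rule nonzero_eq_divide_eq[THEN iffD1, OF _ refl])
  qed
  finally have pH: "l2_norm R_plus (\<lambda>t. ?J t * p t - ?J t * H n t) \<le> e / 3" .
  have close: "l2_norm R_plus (\<lambda>t. ?J t * p t - g t) < e"
    using l2_norm_triangle_diff[OF Jp JH g] l2_norm_triangle_diff[OF JH Tl2[of k] g] pH n k by linarith
  define \<phi> where "\<phi> = bump_poly c d 0 p"
  have cd: "c < d" using ab by simp
  have cont: "continuous_on UNIV \<phi>"
  proof -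
    obtain p' where "\<And>t. (\<phi> has_vector_derivative bump_poly c d (0 + 2) p' t) (at t)"
      using bump_poly_derivative[OF cd p(1), of 0] unfolding \<phi>_def by blast
    then show ?thesis
      by (blast intro: continuous_at_imp_continuous_on has_vector_derivative_continuous)
  qed
  have m\<phi> [measurable]: "\<phi> \<in> borel_measurable R_plus"
    by (rule borel_measurable_R_plus[OF borel_measurable_continuous_onI[OF cont]])
  have "l2_norm R_plus (\<lambda>t. \<phi> t - f t) \<le> l2_norm R_plus (\<lambda>t. ?J t * p t - g t)"
  proof (rule l2_norm_mono[OF l2_diff[OF Jp g]])
    show "(\<lambda>t. \<phi> t - f t) \<in> borel_measurable R_plus" by measurable
    show "AE t in R_plus. cmod (\<phi> t - f t) \<le> cmod (?J t * p t - g t)"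
    proof (rule AE_I2)
      fix t
      show "cmod (\<phi> t - f t) \<le> cmod (?J t * p t - g t)"
      proof (cases "c < t \<and> t < d")
        case True
        then have "w t > 0" by (simp add: w_def)
        have "\<phi> t - f t = exp (- 1 / w t) *\<^sub>R (?J t * p t - g t)"
          using True by (simp add: \<phi>_def bump_poly_def w_def fg scaleR_diff_right)
        moreover have "exp (- 1 / w t) \<le> 1" using \<open>w t > 0\<close> by simp
        ultimately show ?thesis by (simp add: mult_left_le_one_le)
      next
        case False
        then have "\<phi> t = 0" "f t = 0" using supp[of t] ab by (auto simp: \<phi>_def bump_poly_def)
        then show ?thesis by simp
      qed
    qed
  qed
  with close have "l2_norm R_plus (\<lambda>t. \<phi> t - f t) < e" by linarith
  moreover have "\<phi> \<in> C0_inf_plus"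
    unfolding \<phi>_def by (rule bump_poly_in_C0_inf_plus[OF ab(1) cd p(1)])
  moreover have "\<phi> t = 0" if "t \<notin> {c..d}" for t
    using that by (auto simp: \<phi>_def bump_poly_def)
  ultimately show ?thesis using that cont by blast
qed

section \<open>The Laplace transform and translations on the half-line\<close>

lemma exp_l2_R_plus:
  assumes s: "s > 0"
  shows "(\<lambda>t. of_real (exp (- (t * s)))) \<in> l2 R_plus"
    and "l2_norm R_plus (\<lambda>t. of_real (exp (- (t * s)))) = 1 / sqrt (2 * s)"
proof -
  let ?e = "\<lambda>t. complex_of_real (exp (- (t * s)))"
  have hi: "((\<lambda>t. exp (- (2 * s) * t)) has_integral exp (- (2 * s) * 0) / (2 * s)) {0..}"
    using s by (intro has_integral_exp_minus_to_infinity) simp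
  then have "((\<lambda>t. exp (- (2 * s) * t)) has_integral 1 / (2 * s)) {0<..}"
  proof -
    have "negligible ({0..} - {0<..} :: real set)" "negligible ({0<..} - {0..} :: real set)"
      by (auto intro: negligible_subset[OF negligible_sing[of "0::real"]])
    then show ?thesis
      using has_integral_spike_set_eq[of "{0..}" "{0<..}" "\<lambda>t. exp (- (2 * s) * t)" "1 / (2 * s)"] hi
      by (auto intro: negligible_subset)
  qed
  moreover have "(\<lambda>t. exp (- (2 * s) * t)) = (\<lambda>t. (cmod (?e t))\<^sup>2)"
    by (auto simp: power2_eq_square algebra_simps simp flip: exp_add)
  ultimately have hi2: "((\<lambda>t. (cmod (?e t))\<^sup>2) has_integral 1 / (2 * s)) {0<..}" by simp
  have "(\<lambda>t. (cmod (?e t))\<^sup>2) absolutely_integrable_on {0<..}"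
    using hi2 by (intro nonnegative_absolutely_integrable_1) (auto simp: integrable_on_def)
  then have sil: "set_integrable lborel {0<..} (\<lambda>t. (cmod (?e t))\<^sup>2)"
    unfolding set_integrable_def by (subst (asm) integrable_completion) measurable
  then have "(\<integral>t\<in>{0<..}. (cmod (?e t))\<^sup>2 \<partial>lborel) = 1 / (2 * s)"
    using set_borel_integral_eq_integral(2)[OF sil] hi2 by (simp add: integral_unique)
  then have "(\<integral>t. (cmod (?e t))\<^sup>2 \<partial>R_plus) = 1 / (2 * s)"
    by (subst integral_restrict_space) (simp_all add: set_lebesgue_integral_def)
  then show "l2_norm R_plus ?e = 1 / sqrt (2 * s)"
    by (simp add: l2_norm_def real_sqrt_divide)
  have "integrable R_plus (\<lambda>t. (cmod (?e t))\<^sup>2)"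
    using sil unfolding set_integrable_def by (subst integrable_restrict_space) auto
  moreover have "?e \<in> borel_measurable R_plus"
    by (rule borel_measurable_R_plus) measurable
  ultimately show "?e \<in> l2 R_plus" by (simp add: l2_def)
qed

lemma laplace_bound:
  assumes f: "f \<in> l2 R_plus" and s: "s > 0"
  shows laplace_integrable: "integrable R_plus (\<lambda>t. of_real (exp (- (t * s))) * f t)"
    and laplace_le: "cmod (laplace f s) \<le> l2_norm R_plus f / sqrt (2 * s)"
proof -
  note e = exp_l2_R_plus[OF s]
  show "integrable R_plus (\<lambda>t. of_real (exp (- (t * s))) * f t)"
    by (rule l2_mult_integrable[OF e(1) f])
  have "cmod (laplace f s) \<le> (\<integral>t. cmod (of_real (exp (- (t * s))) * f t) \<partial>R_plus)"
    unfolding laplace_def by (rule integral_norm_bound)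
  also have "\<dots> \<le> 1 / sqrt (2 * s) * l2_norm R_plus f"
    using l2_mult_integral_le[OF e(1) f] e(2) by (simp add: norm_mult)
  finally show "cmod (laplace f s) \<le> l2_norm R_plus f / sqrt (2 * s)" by simp
qed

text \<open>Support away from \<open>0\<close> gives exponential decay, and bounded support gives integrability up to \<open>s = 0\<close>.\<close>

lemma laplace_bound_supported:
  assumes f: "f \<in> l2 R_plus" and supp: "\<And>t. t \<notin> {c..d} \<Longrightarrow> f t = 0" and cd: "0 < c" "c \<le> d" and s: "s \<ge> 0"
  shows laplace_integrable_supported: "integrable R_plus (\<lambda>t. of_real (exp (- (t * s))) * f t)"
    and laplace_le_supported: "cmod (laplace f s) \<le> exp (- (c * s)) * sqrt (d - c) * l2_norm R_plus f"
proof -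
  let ?J = "\<lambda>t. complex_of_real (indicator {c..d} t)"
  let ?K = "\<lambda>t. complex_of_real (indicator {c..d} t * exp (- (t * s)))"
  note J = indicator_Icc_l2[OF cd]
  have mK: "?K \<in> borel_measurable R_plus"
    by (rule borel_measurable_R_plus) measurable
  have le: "AE t in R_plus. cmod (?K t) \<le> cmod (of_real (exp (- (c * s))) * ?J t)"
    using s by (intro AE_I2) (auto simp: norm_mult indicator_def intro!: mult_right_mono)
  note K = l2_of_dominated[OF l2_scale(1)[OF J(1)] mK le]
  have nK: "l2_norm R_plus ?K \<le> exp (- (c * s)) * sqrt (d - c)"
    using l2_norm_mono[OF l2_scale(1)[OF J(1)] mK le] by (simp add: l2_scale(2)[OF J(1)] J(2))
  have eq: "(\<lambda>t. of_real (exp (- (t * s))) * f t) = (\<lambda>t. ?K t * f t)"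
  proof
    show "of_real (exp (- (t * s))) * f t = ?K t * f t" for t
      using supp[of t] by (cases "t \<in> {c..d}") auto
  qed
  show "integrable R_plus (\<lambda>t. of_real (exp (- (t * s))) * f t)"
    unfolding eq by (rule l2_mult_integrable[OF K f])
  have "cmod (laplace f s) \<le> (\<integral>t. cmod (?K t * f t) \<partial>R_plus)"
    unfolding laplace_def eq by (rule integral_norm_bound)
  also have "\<dots> \<le> l2_norm R_plus ?K * l2_norm R_plus f"
    using l2_mult_integral_le[OF K f] by (simp add: norm_mult)
  also have "\<dots> \<le> (exp (- (c * s)) * sqrt (d - c)) * l2_norm R_plus f"
    by (rule mult_right_mono[OF nK l2_norm_nonneg])
  finally show "cmod (laplace f s) \<le> exp (- (c * s)) * sqrt (d - c) * l2_norm R_plus f" .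
qed

lemma laplace_cong_AE:
  assumes "f \<in> borel_measurable R_plus" "g \<in> borel_measurable R_plus" "AE t in R_plus. f t = g t"
  shows "laplace f s = laplace g s"
proof -
  have "(\<lambda>t. complex_of_real (exp (- (t * s)))) \<in> borel_measurable R_plus"
    by (rule borel_measurable_R_plus) measurable
  then show ?thesis
    unfolding laplace_def using assms by (intro integral_cong_AE) (auto elim: eventually_mono)
qed

lemma laplace_measurable:
  assumes f: "f \<in> borel_measurable R_plus"
  shows "laplace f \<in> borel_measurable borel"
proof -
  have [measurable]: "(\<lambda>t. indicator {0<..} t *\<^sub>R f t) \<in> borel_measurable borel"
    using f by (simp add: borel_measurable_R_plus_iff)
  have "laplace f = (\<lambda>s. \<integral>t. of_real (exp (- (t * s))) * (indicator {0<..} t *\<^sub>R f t) \<partial>lborel)"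
    unfolding laplace_def[abs_def] by (subst integral_restrict_space) simp_all
  also have "\<dots> \<in> borel_measurable borel"
    by (rule lborel.borel_measurable_lebesgue_integral) measurable
  finally show ?thesis .
qed

lemma laplace_diff:
  assumes "f \<in> l2 R_plus" "g \<in> l2 R_plus" "s > 0"
  shows "laplace (\<lambda>t. f t - g t) s = laplace f s - laplace g s"
  unfolding laplace_def right_diff_distrib
  by (intro Bochner_Integration.integral_diff laplace_integrable assms)

lemma laplace_scale: "laplace (\<lambda>t. c * f t) s = c * laplace f s"
  unfolding laplace_def mult.left_commute[of _ c] by simp

lemma laplace_sum:
  assumes "\<And>i. i \<in> I \<Longrightarrow> F i \<in> l2 R_plus" "s > 0"
  shows "laplace (\<lambda>t. \<Sum>i\<in>I. F i t) s = (\<Sum>i\<in>I. laplace (F i) s)"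
  unfolding laplace_def sum_distrib_left
  by (intro Bochner_Integration.integral_sum laplace_integrable assms)

text \<open>The factor \<open>indicator {0<..} (t - a)\<close> discards the values of \<open>f\<close> off the half-line, about which
  membership in \<open>l2 R_plus\<close> says nothing.\<close>

definition shift :: "real \<Rightarrow> (real \<Rightarrow> complex) \<Rightarrow> real \<Rightarrow> complex" where
  "shift a f t = indicator {0<..} (t - a) *\<^sub>R f (t - a)"

lemma shift_l2:
  assumes f: "f \<in> l2 R_plus" and a: "a \<ge> 0"
  shows "shift a f \<in> l2 R_plus" and "l2_norm R_plus (shift a f) = l2_norm R_plus f"
proof -
  let ?F = "\<lambda>t. indicator {0<..} t *\<^sub>R (cmod (f t))\<^sup>2"
  have mf: "(\<lambda>t. indicator {0<..} t *\<^sub>R f t) \<in> borel_measurable borel"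
    using l2_measurable[OF f] by (simp add: borel_measurable_R_plus_iff)
  have "(\<lambda>t. indicator {0<..} (t - a) *\<^sub>R f (t - a)) \<in> borel_measurable borel"
    by (rule measurable_compose[OF _ mf]) measurable
  then have m: "shift a f \<in> borel_measurable R_plus"
    unfolding shift_def[abs_def] by (rule borel_measurable_R_plus)
  have eq: "indicator {0<..} t *\<^sub>R (cmod (shift a f t))\<^sup>2 = ?F (- a + 1 * t)" for t
    using a by (auto simp: shift_def indicator_def)
  have iF: "integrable lborel ?F"
    using l2_integrable[OF f] by (subst (asm) integrable_restrict_space) auto
  have "integrable R_plus (\<lambda>t. (cmod (shift a f t))\<^sup>2)"
    by (subst integrable_restrict_space, simp, unfold eq)
       (rule lborel_integrable_real_affine[OF iF], simp)
  with m show "shift a f \<in> l2 R_plus" by (simp add: l2_def)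
  have "(\<integral>t. (cmod (shift a f t))\<^sup>2 \<partial>R_plus) = (\<integral>t. ?F (- a + 1 * t) \<partial>lborel)"
    by (subst integral_restrict_space) (simp_all only: eq, auto)
  also have "\<dots> = (\<integral>t. ?F t \<partial>lborel)"
    using lborel_integral_real_affine[of 1 ?F "- a"] by simp
  also have "\<dots> = (\<integral>t. (cmod (f t))\<^sup>2 \<partial>R_plus)"
    by (subst integral_restrict_space) auto
  finally show "l2_norm R_plus (shift a f) = l2_norm R_plus f" by (simp add: l2_norm_def)
qed

lemma laplace_shift:
  assumes a: "a \<ge> 0"
  shows "laplace (shift a f) s = of_real (exp (- (a * s))) * laplace f s"
proof -
  let ?F = "\<lambda>t. of_real (exp (- (a * s))) * (indicator {0<..} t *\<^sub>R (of_real (exp (- (t * s))) * f t))"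
  have eq: "indicator {0<..} t *\<^sub>R (of_real (exp (- (t * s))) * shift a f t) = ?F (- a + 1 * t)" for t
    using a by (auto simp: shift_def indicator_def algebra_simps simp flip: exp_add of_real_mult)
  have "laplace (shift a f) s = (\<integral>t. ?F (- a + 1 * t) \<partial>lborel)"
    unfolding laplace_def by (subst integral_restrict_space) (simp_all only: eq, auto)
  also have "\<dots> = (\<integral>t. ?F t \<partial>lborel)"
    using lborel_integral_real_affine[of 1 ?F "- a"] by simp
  also have "\<dots> = of_real (exp (- (a * s))) * laplace f s"
    unfolding laplace_def
    by (subst integral_restrict_space) (simp_all flip: mult_scaleR_right)
  finally show ?thesis .
qed

lemma shift_diff: "shift a (\<lambda>t. f t - g t) = (\<lambda>t. shift a f t - shift a g t)"
  by (auto simp: shift_def scaleR_diff_right)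

definition truncate :: "nat \<Rightarrow> (real \<Rightarrow> complex) \<Rightarrow> real \<Rightarrow> complex" where
  "truncate N f t = indicator {1 / real (Suc N)..real (Suc N)} t *\<^sub>R f t"

lemma truncate_l2:
  assumes f: "f \<in> l2 R_plus"
  shows "truncate N f \<in> l2 R_plus"
    and "(\<lambda>N. l2_norm R_plus (\<lambda>t. f t - truncate N f t)) \<longlonglongrightarrow> 0"
proof -
  have [measurable]: "f \<in> borel_measurable R_plus" by (rule l2_measurable[OF f])
  have [measurable]: "(\<lambda>t. indicator {1 / real (Suc N)..real (Suc N)} t :: real) \<in> borel_measurable R_plus" for N
    by (rule borel_measurable_R_plus) measurable
  have [measurable]: "truncate N f \<in> borel_measurable R_plus" for N
    unfolding truncate_def[abs_def] by measurable
  show "truncate N f \<in> l2 R_plus"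
    by (rule l2_of_dominated[OF f]) (auto simp: truncate_def indicator_def)
  show "(\<lambda>N. l2_norm R_plus (\<lambda>t. f t - truncate N f t)) \<longlonglongrightarrow> 0"
  proof (rule l2_dominated_convergence[OF f])
    show "AE t in R_plus. (\<lambda>N. f t - truncate N f t) \<longlonglongrightarrow> 0"
    proof (rule AE_I2)
      fix t assume "t \<in> space R_plus"
      then have t: "t > 0" by (simp add: space_restrict_space)
      have "\<forall>\<^sub>F N in sequentially. f t - truncate N f t = 0"
        using eventually_ge_at_top[of "nat \<lceil>t\<rceil>"] eventually_ge_at_top[of "nat \<lceil>1 / t\<rceil>"]
      proof eventually_elim
        case (elim N)
        then have "t \<le> real N" "1 / t \<le> real N" using t by (simp_all add: nat_ceiling_le_eq)
        then have "t \<le> real (Suc N)" "1 / t \<le> real (Suc N)" by simp_all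
        then show ?case using t by (simp add: truncate_def indicator_def field_simps)
      qed
      then show "(\<lambda>N. f t - truncate N f t) \<longlonglongrightarrow> 0" by (rule tendsto_eventually)
    qed
    show "(\<lambda>t. f t - truncate N f t) \<in> borel_measurable R_plus" for N by measurable
  qed (auto simp: truncate_def indicator_def)
qed

lemma supported_in_E_plus:
  assumes "f \<in> l2 R_plus" "0 < c" "\<And>t. t \<notin> {c..d} \<Longrightarrow> f t = 0"
  shows "f \<in> E_plus"
  unfolding E_plus_def using assms by (auto intro!: exI[of _ "{c..d}"] AE_I2)

text \<open>Shifts are isometries, so it suffices to treat a dense set.  For a continuous function of compact
  support the claim is dominated convergence.\<close>

lemma shift_tendsto:
  assumes f: "f \<in> l2 R_plus" and a: "a \<longlonglongrightarrow> 0" "\<And>n. 0 \<le> a n" "\<And>n. a n \<le> 1"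
  shows "(\<lambda>n. l2_norm R_plus (\<lambda>t. shift (a n) f t - f t)) \<longlonglongrightarrow> 0"
proof (rule LIMSEQ_I)
  fix e :: real assume e: "e > 0"
  then have e4: "e / 5 > 0" by simp
  have "\<forall>\<^sub>F N in sequentially. l2_norm R_plus (\<lambda>t. f t - truncate N f t) < e / 5"
    using order_tendstoD(2)[OF truncate_l2(2)[OF f] e4] .
  then obtain N where N: "l2_norm R_plus (\<lambda>t. f t - truncate N f t) < e / 5"
    by (auto simp: eventually_sequentially)
  let ?c = "1 / real (Suc N) / 2" and ?d = "real (Suc N) + 1"
  note trl2 = truncate_l2(1)[OF f, of N]
  have ab: "0 < ?c" "?c < 1 / real (Suc N)" "1 / real (Suc N) \<le> real (Suc N)" "real (Suc N) < ?d"
    by (auto simp: field_simps)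
  have "truncate N f t = 0" if "t \<notin> {1 / real (Suc N)..real (Suc N)}" for t
    using that by (simp add: truncate_def)
  from smooth_approximation[OF trl2 this ab e4] obtain \<phi>
    where \<phi>: "\<phi> \<in> C0_inf_plus" "continuous_on UNIV \<phi>" "\<And>t. t \<notin> {?c..?d} \<Longrightarrow> \<phi> t = 0"
    "l2_norm R_plus (\<lambda>t. \<phi> t - truncate N f t) < e / 5"
    by blast
  have \<phi>l2: "\<phi> \<in> l2 R_plus" using \<phi>(1) C0_inf_plus_subset_E_plus E_plus_subset_l2 by blast
  have close: "l2_norm R_plus (\<lambda>t. f t - \<phi> t) < 2 * e / 5"
    using l2_norm_triangle_diff[OF f trl2 \<phi>l2] N \<phi>(4) l2_norm_minus_commute[of R_plus \<phi> "truncate N f"] by simp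
  obtain B where B: "\<And>t. t \<in> {?c..?d} \<Longrightarrow> cmod (\<phi> t) \<le> B"
    using compact_imp_bounded[OF compact_continuous_image[OF continuous_on_subset[OF \<phi>(2) subset_UNIV] compact_Icc]]
    unfolding bounded_iff by blast
  have B0: "B \<ge> 0" using B[of ?c] norm_ge_zero[of "\<phi> ?c"] ab by (smt (verit) atLeastAtMost_iff)
  have B': "cmod (\<phi> t) \<le> B" for t using B[of t] \<phi>(3)[of t] B0 by (cases "t \<in> {?c..?d}") auto
  let ?J = "\<lambda>t. complex_of_real (indicator {?c..?d + 1} t)"
  have J: "?J \<in> l2 R_plus" using ab by (intro indicator_Icc_l2) auto
  have sh: "shift (a n) \<phi> t = \<phi> (t - a n)" for n t
  proof (cases "t - a n > 0")
    case False
    then have "t - a n \<notin> {?c..?d}" using ab(1) by (metis atLeastAtMost_iff less_le_trans)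
    then show ?thesis using False \<phi>(3) by (simp add: shift_def)
  qed (simp add: shift_def)
  have m\<phi>: "(\<lambda>t. \<phi> (t - x) - \<phi> t) \<in> borel_measurable R_plus" for x
    by (intro borel_measurable_R_plus borel_measurable_continuous_onI continuous_on_diff \<phi>(2)
        continuous_on_compose2[OF \<phi>(2)] continuous_intros) auto
  have "(\<lambda>n. l2_norm R_plus (\<lambda>t. \<phi> (t - a n) - \<phi> t)) \<longlonglongrightarrow> 0"
  proof (rule l2_dominated_convergence[OF l2_scale(1)[OF J, of "of_real (2 * B)"] m\<phi>])
    show "AE t in R_plus. (\<lambda>n. \<phi> (t - a n) - \<phi> t) \<longlonglongrightarrow> 0"
    proof (rule AE_I2)
      fix t
      have "(\<lambda>n. t - a n) \<longlonglongrightarrow> t - 0" by (intro tendsto_intros a)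
      moreover have "isCont \<phi> (t - 0)" using \<phi>(2) by (simp add: continuous_on_eq_continuous_at)
      ultimately have "(\<lambda>n. \<phi> (t - a n)) \<longlonglongrightarrow> \<phi> (t - 0)" by (rule isCont_tendsto_compose[rotated])
      then show "(\<lambda>n. \<phi> (t - a n) - \<phi> t) \<longlonglongrightarrow> 0" by (simp add: LIM_zero_iff)
    qed
    show "AE t in R_plus. cmod (\<phi> (t - a n) - \<phi> t) \<le> cmod (of_real (2 * B) * ?J t)" for n
    proof (rule AE_I2)
      fix t
      show "cmod (\<phi> (t - a n) - \<phi> t) \<le> cmod (of_real (2 * B) * ?J t)"
      proof (cases "t \<in> {?c..?d + 1}")
        case True
        then show ?thesis
          using norm_triangle_ineq4[of "\<phi> (t - a n)" "\<phi> t"] B'[of t] B'[of "t - a n"] B0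
          by (simp add: norm_mult)
      next
        case False
        then have "t \<notin> {?c..?d}" "t - a n \<notin> {?c..?d}" using a(2,3)[of n] by auto
        then show ?thesis using \<phi>(3) by simp
      qed
    qed
  qed
  from order_tendstoD(2)[OF this e4] obtain n0
    where n0: "\<And>n. n \<ge> n0 \<Longrightarrow> l2_norm R_plus (\<lambda>t. shift (a n) \<phi> t - \<phi> t) < e / 5"
    unfolding sh by (auto simp: eventually_sequentially)
  have "l2_norm R_plus (\<lambda>t. shift (a n) f t - f t) < e" if "n \<ge> n0" for n
  proof -
    have "l2_norm R_plus (\<lambda>t. shift (a n) f t - shift (a n) \<phi> t) = l2_norm R_plus (\<lambda>t. f t - \<phi> t)"
      using shift_l2(2)[OF l2_diff[OF f \<phi>l2] a(2)[of n]] by (simp add: shift_diff)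
    moreover have "l2_norm R_plus (\<lambda>t. shift (a n) f t - f t)
        \<le> l2_norm R_plus (\<lambda>t. shift (a n) f t - shift (a n) \<phi> t) + l2_norm R_plus (\<lambda>t. shift (a n) \<phi> t - f t)"
      by (intro l2_norm_triangle_diff shift_l2 f \<phi>l2 a)
    moreover have "l2_norm R_plus (\<lambda>t. shift (a n) \<phi> t - f t)
        \<le> l2_norm R_plus (\<lambda>t. shift (a n) \<phi> t - \<phi> t) + l2_norm R_plus (\<lambda>t. \<phi> t - f t)"
      by (intro l2_norm_triangle_diff shift_l2 f \<phi>l2 a)
    ultimately show ?thesis
      using close n0[OF that] l2_norm_minus_commute[of R_plus f \<phi>] by linarith
  qed
  then show "\<exists>n0. \<forall>n\<ge>n0. norm (l2_norm R_plus (\<lambda>t. shift (a n) f t - f t) - 0) < e"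
    by (auto simp: l2_norm_nonneg)
qed

section \<open>Regularisation by translations\<close>

text \<open>The step \<open>n\<close> of the shifts grows with their number, so that shifts of a function with bounded support
  eventually do not overlap.\<close>

definition shift_average :: "nat \<Rightarrow> (real \<Rightarrow> complex) \<Rightarrow> real \<Rightarrow> complex" where
  "shift_average n f t = of_real (1 / real n) * (\<Sum>j=1..n. shift (real (j * n)) f t)"

lemma shift_average_l2:
  assumes f: "f \<in> l2 R_plus"
  shows "shift_average n f \<in> l2 R_plus" and "l2_norm R_plus (shift_average n f) \<le> l2_norm R_plus f"
proof -
  have sl: "shift (real (j * n)) f \<in> l2 R_plus" "l2_norm R_plus (shift (real (j * n)) f) = l2_norm R_plus f" for j
    by (intro shift_l2 f; simp)+
  have s: "(\<lambda>t. \<Sum>j=1..n. shift (real (j * n)) f t) \<in> l2 R_plus"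
    by (intro l2_sum sl)
  show "shift_average n f \<in> l2 R_plus"
    unfolding shift_average_def[abs_def] by (intro l2_scale s)
  have "l2_norm R_plus (\<lambda>t. \<Sum>j=1..n. shift (real (j * n)) f t) \<le> (\<Sum>j=1..n. l2_norm R_plus (shift (real (j * n)) f))"
    by (intro l2_sum sl)
  also have "\<dots> = real n * l2_norm R_plus f" by (simp only: sl) simp
  finally have le: "l2_norm R_plus (\<lambda>t. \<Sum>j=1..n. shift (real (j * n)) f t) \<le> real n * l2_norm R_plus f" .
  have eq: "l2_norm R_plus (shift_average n f) = 1 / real n * l2_norm R_plus (\<lambda>t. \<Sum>j=1..n. shift (real (j * n)) f t)"
    unfolding shift_average_def[abs_def] by (subst l2_scale(2)[OF s]) (simp add: norm_divide)
  show "l2_norm R_plus (shift_average n f) \<le> l2_norm R_plus f"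
    using le l2_norm_nonneg[of R_plus f] unfolding eq by (cases "n = 0") (auto simp: field_simps)
qed

lemma shift_average_diff: "shift_average n (\<lambda>t. f t - g t) = (\<lambda>t. shift_average n f t - shift_average n g t)"
  by (auto simp: shift_average_def shift_diff sum_subtractf right_diff_distrib)

lemma cmod_sum_squared_of_disjoint:
  fixes z :: "'i \<Rightarrow> complex"
  assumes "finite I" "\<And>i j. i \<in> I \<Longrightarrow> j \<in> I \<Longrightarrow> i \<noteq> j \<Longrightarrow> z i = 0 \<or> z j = 0"
  shows "(cmod (\<Sum>i\<in>I. z i))\<^sup>2 = (\<Sum>i\<in>I. (cmod (z i))\<^sup>2)"
proof (cases "\<exists>i\<in>I. z i \<noteq> 0")
  case True
  then obtain i where i: "i \<in> I" "z i \<noteq> 0" by blast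
  then have "\<forall>j\<in>I - {i}. z j = 0" using assms(2) by blast
  then show ?thesis
    using assms(1) i(1) by (simp add: sum.remove[of I i])
qed auto

text \<open>If \<open>f\<close> has bounded support, its shifts by distinct multiples of a large \<open>n\<close> have disjoint supports, so
  that the norm of the average is \<open>1 / sqrt n\<close> times that of \<open>f\<close>.  The general case follows because
  the averages are contractions.\<close>

lemma shift_average_tendsto:
  assumes f: "f \<in> l2 R_plus"
  shows "(\<lambda>n. l2_norm R_plus (shift_average n f)) \<longlonglongrightarrow> 0"
proof (rule LIMSEQ_I)
  fix e :: real assume e: "e > 0"
  then have e2: "e / 2 > 0" by simp
  obtain N where N: "l2_norm R_plus (\<lambda>t. f t - truncate N f t) < e / 2"
    using order_tendstoD(2)[OF truncate_l2(2)[OF f] e2] by (auto simp: eventually_sequentially)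
  define g where "g = truncate N f"
  have g: "g \<in> l2 R_plus" unfolding g_def by (rule truncate_l2(1)[OF f])
  have g0: "g t = 0" if "t > real (Suc N)" for t using that by (simp add: g_def truncate_def)
  have sl: "shift (real (j * n)) g \<in> l2 R_plus" "l2_norm R_plus (shift (real (j * n)) g) = l2_norm R_plus g" for j n
    by (intro shift_l2 g; simp)+
  have norm: "(l2_norm R_plus (shift_average n g))\<^sup>2 = (l2_norm R_plus g)\<^sup>2 / real n" if n: "n \<ge> Suc N" for n
  proof -
    have pt: "(cmod (\<Sum>j=1..n. shift (real (j * n)) g t))\<^sup>2 = (\<Sum>j=1..n. (cmod (shift (real (j * n)) g t))\<^sup>2)" for t
    proof (rule cmod_sum_squared_of_disjoint)
      have zero: "shift (real (i * n)) g t = 0" if "i < j" "shift (real (j * n)) g t \<noteq> 0" for i j :: nat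
      proof -
        have "(i + 1) * n \<le> j * n" using that(1) by (intro mult_right_mono) auto
        then have "real (i * n) + real n \<le> real (j * n)" by (simp only: of_nat_add[symmetric] of_nat_le_iff) simp
        moreover have "t > real (j * n)" using that(2) by (auto simp: shift_def indicator_def split: if_splits)
        ultimately have "t - real (i * n) > real (Suc N)" using n by linarith
        then show ?thesis using g0 by (simp add: shift_def)
      qed
      show "shift (real (i * n)) g t = 0 \<or> shift (real (j * n)) g t = 0" if "i \<noteq> j" for i j
        using zero[of i j] zero[of j i] that by linarith
    qed simp
    have "(l2_norm R_plus (shift_average n g))\<^sup>2
        = (\<integral>t. (1 / real n)\<^sup>2 * (\<Sum>j=1..n. (cmod (shift (real (j * n)) g t))\<^sup>2) \<partial>R_plus)"
      unfolding l2_norm_squared shift_average_def norm_mult power_mult_distrib pt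
      by (simp add: norm_divide)
    also have "\<dots> = (1 / real n)\<^sup>2 * (\<Sum>j=1..n. \<integral>t. (cmod (shift (real (j * n)) g t))\<^sup>2 \<partial>R_plus)"
      using l2_integrable[OF sl(1)] by (subst integral_mult_right_zero, subst Bochner_Integration.integral_sum) auto
    also have "(\<Sum>j=1..n. \<integral>t. (cmod (shift (real (j * n)) g t))\<^sup>2 \<partial>R_plus) = real n * (l2_norm R_plus g)\<^sup>2"
      by (simp only: l2_norm_squared[symmetric] sl(2)) simp
    finally show ?thesis using n by (simp add: power2_eq_square field_simps)
  qed
  have "(\<lambda>n. sqrt ((l2_norm R_plus g)\<^sup>2 / real n)) \<longlonglongrightarrow> sqrt 0"
    by (intro tendsto_intros lim_const_over_n)
  then have "(\<lambda>n. sqrt ((l2_norm R_plus g)\<^sup>2 / real n)) \<longlonglongrightarrow> 0" by simp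
  from order_tendstoD(2)[OF this e2] obtain n0 where n0: "\<And>n. n \<ge> n0 \<Longrightarrow> sqrt ((l2_norm R_plus g)\<^sup>2 / real n) < e / 2"
    by (auto simp: eventually_sequentially)
  have "l2_norm R_plus (shift_average n f) < e" if "n \<ge> max n0 (Suc N)" for n
  proof -
    have "l2_norm R_plus (shift_average n g) = sqrt ((l2_norm R_plus g)\<^sup>2 / real n)"
      using norm[of n] that by (metis l2_norm_nonneg max.bounded_iff real_sqrt_unique)
    then have "l2_norm R_plus (shift_average n g) < e / 2" using n0[of n] that by simp
    moreover have "l2_norm R_plus (shift_average n (\<lambda>t. f t - g t)) < e / 2"
      using shift_average_l2(2)[OF l2_diff[OF f g], of n] N unfolding g_def by linarith
    moreover have "l2_norm R_plus (shift_average n f)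
        \<le> l2_norm R_plus (shift_average n (\<lambda>t. f t - g t)) + l2_norm R_plus (shift_average n g)"
      using l2_norm_triangle[OF shift_average_l2(1)[OF l2_diff[OF f g], of n] shift_average_l2(1)[OF g, of n]]
      by (simp add: shift_average_diff)
    ultimately show ?thesis by linarith
  qed
  then show "\<exists>n0. \<forall>n\<ge>n0. norm (l2_norm R_plus (shift_average n f) - 0) < e"
    by (intro exI[of _ "max n0 (Suc N)"]) (simp add: l2_norm_nonneg)
qed

text \<open>The average removes the mean value, which makes the transform vanish at \<open>0\<close>; the outer shift moves the
  support away from \<open>0\<close>, which makes the transform decay at infinity.\<close>

definition mollify :: "nat \<Rightarrow> (real \<Rightarrow> complex) \<Rightarrow> real \<Rightarrow> complex" where
  "mollify n f = shift (1 / real n) (\<lambda>t. f t - shift_average n f t)"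

definition mollify_symbol :: "nat \<Rightarrow> real \<Rightarrow> real" where
  "mollify_symbol n s = exp (- (1 / real n * s)) * (1 - 1 / real n * (\<Sum>j=1..n. exp (- (real (j * n) * s))))"

lemma mollify_l2:
  assumes f: "f \<in> l2 R_plus"
  shows "mollify n f \<in> l2 R_plus"
  unfolding mollify_def by (intro shift_l2 l2_diff shift_average_l2 f) simp

lemma mollify_diff: "mollify n (\<lambda>t. f t - g t) = (\<lambda>t. mollify n f t - mollify n g t)"
proof -
  have "(\<lambda>t. f t - g t - shift_average n (\<lambda>t. f t - g t) t)
      = (\<lambda>t. (f t - shift_average n f t) - (g t - shift_average n g t))"
    by (simp add: shift_average_diff fun_eq_iff)
  then show ?thesis by (simp add: mollify_def shift_diff)
qed

lemma mollify_norm_le: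
  assumes f: "f \<in> l2 R_plus"
  shows "l2_norm R_plus (mollify n f) \<le> 2 * l2_norm R_plus f"
proof -
  note A = shift_average_l2[OF f, of n]
  have "l2_norm R_plus (mollify n f) = l2_norm R_plus (\<lambda>t. f t - shift_average n f t)"
    unfolding mollify_def by (intro shift_l2(2) l2_diff A f) simp
  also have "\<dots> \<le> l2_norm R_plus f + l2_norm R_plus (\<lambda>t. - 1 * shift_average n f t)"
    using l2_norm_triangle[OF f l2_scale(1)[OF A(1), of "- 1"]] by simp
  also have "\<dots> \<le> 2 * l2_norm R_plus f"
    using A(2) unfolding l2_scale(2)[OF A(1)] by simp
  finally show ?thesis .
qed

lemma mollify_tendsto:
  assumes f: "f \<in> l2 R_plus"
  shows "(\<lambda>n. l2_norm R_plus (\<lambda>t. mollify (Suc n) f t - f t)) \<longlonglongrightarrow> 0"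
proof -
  let ?s = "\<lambda>n. shift (1 / real (Suc n)) f" and ?A = "\<lambda>n. shift_average (Suc n) f"
  note A = shift_average_l2(1)[OF f]
  have "(\<lambda>n. 1 / real (Suc n)) \<longlonglongrightarrow> 0"
    using LIMSEQ_inverse_real_of_nat by (simp add: inverse_eq_divide)
  then have "(\<lambda>n. l2_norm R_plus (\<lambda>t. ?s n t - f t)) \<longlonglongrightarrow> 0"
    by (rule shift_tendsto[OF f]) auto
  moreover have "(\<lambda>n. l2_norm R_plus (?A n)) \<longlonglongrightarrow> 0"
    using LIMSEQ_Suc[OF shift_average_tendsto[OF f]] .
  ultimately have lim: "(\<lambda>n. l2_norm R_plus (?A n) + l2_norm R_plus (\<lambda>t. ?s n t - f t)) \<longlonglongrightarrow> 0"
    using tendsto_add by fastforce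
  have le: "l2_norm R_plus (\<lambda>t. mollify (Suc n) f t - f t)
      \<le> l2_norm R_plus (?A n) + l2_norm R_plus (\<lambda>t. ?s n t - f t)" for n
  proof -
    have "l2_norm R_plus (\<lambda>t. mollify (Suc n) f t - ?s n t)
        = l2_norm R_plus (shift (1 / real (Suc n)) (\<lambda>t. (f t - ?A n t) - f t))"
      by (simp only: mollify_def shift_diff)
    also have "\<dots> = l2_norm R_plus (\<lambda>t. (f t - ?A n t) - f t)"
      by (intro shift_l2(2) l2_diff f A) simp
    also have "\<dots> = l2_norm R_plus (?A n)" by (simp add: l2_norm_def)
    finally show ?thesis
      using l2_norm_triangle_diff[OF mollify_l2[OF f] shift_l2(1)[OF f] f, of "1 / real (Suc n)" "Suc n"] by simp
  qed
  show ?thesis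
    by (rule tendsto_sandwich[OF _ _ tendsto_const lim]) (use le in \<open>auto simp: l2_norm_nonneg\<close>)
qed

lemma mollify_truncate_in_E_plus:
  assumes f: "f \<in> l2 R_plus" and n: "n > 0"
  shows "mollify n (truncate N f) \<in> E_plus"
proof (rule supported_in_E_plus[OF mollify_l2[OF truncate_l2(1)[OF f]]])
  show "0 < 1 / real n" using n by simp
  fix t assume t: "t \<notin> {1 / real n..1 / real n + real (n * n) + real (Suc N)}"
  show "mollify n (truncate N f) t = 0"
  proof (cases "t - 1 / real n > 0")
    case True
    let ?u = "t - 1 / real n"
    have u: "?u > real (n * n) + real (Suc N)" using t True by (simp only: atLeastAtMost_iff) linarith
    have "truncate N f (?u - real (j * n)) = 0" if "j \<in> {1..n}" for j
    proof -
      have "j * n \<le> n * n" using that by simp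
      then have "real (j * n) \<le> real (n * n)" by (simp only: of_nat_le_iff)
      with u have "?u - real (j * n) > real (Suc N)" by linarith
      then show ?thesis by (simp add: truncate_def)
    qed
    then have "shift_average n (truncate N f) ?u = 0"
      unfolding shift_average_def shift_def by (simp del: of_nat_mult)
    moreover have "truncate N f ?u = 0"
    proof -
      have "0 \<le> real (n * n)" by simp
      then have "?u > real (Suc N)" using u by linarith
      then show ?thesis by (simp add: truncate_def)
    qed
    ultimately show ?thesis by (simp add: mollify_def shift_def)
  qed (simp add: mollify_def shift_def)
qed

lemma laplace_mollify:
  assumes f: "f \<in> l2 R_plus" and s: "s > 0"
  shows "laplace (mollify n f) s = of_real (mollify_symbol n s) * laplace f s"
proof -
  define A where "A = 1 / real n * (\<Sum>j=1..n. exp (- (real (j * n) * s)))"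
  have "laplace (shift_average n f) s = of_real A * laplace f s"
    unfolding shift_average_def[abs_def] laplace_scale A_def
    by (subst laplace_sum)
       (auto intro!: shift_l2 f s simp: laplace_shift mult.assoc simp del: of_nat_mult simp flip: sum_distrib_right)
  then have "laplace (mollify n f) s = of_real (exp (- (1 / real n * s))) * (laplace f s - of_real A * laplace f s)"
    unfolding mollify_def
    by (subst laplace_shift, simp, subst laplace_diff[OF f shift_average_l2(1)[OF f] s]) (simp only:)
  also have "\<dots> = of_real (exp (- (1 / real n * s)) * (1 - A)) * laplace f s"
    by (simp add: left_diff_distrib right_diff_distrib)
  finally show ?thesis by (simp only: mollify_symbol_def A_def)
qed

text \<open>The symbol is the mean of the numbers \<open>1 - exp (- (j * n * s))\<close>, each between \<open>0\<close> and \<open>n\<^sup>2 * s\<close>,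
  times an exponential.\<close>

lemma mollify_symbol_bounds:
  assumes n: "n > 0" and s: "s \<ge> 0"
  shows "0 \<le> mollify_symbol n s" "mollify_symbol n s \<le> 1"
    and "mollify_symbol n s \<le> (real n)\<^sup>2 * s * exp (- (1 / real n * s))"
proof -
  let ?S = "\<Sum>j=1..n. exp (- (real (j * n) * s))"
  have up: "?S \<le> real n"
    using sum_bounded_above[of "{1..n}" "\<lambda>j. exp (- (real (j * n) * s))" 1] s by simp
  have low: "?S \<ge> real n * (1 - (real n)\<^sup>2 * s)"
  proof -
    have "exp (- (real (j * n) * s)) \<ge> 1 - (real n)\<^sup>2 * s" if "j \<in> {1..n}" for j
    proof -
      have "1 - real (j * n) * s \<le> exp (- (real (j * n) * s))"
        using exp_ge_add_one_self[of "- (real (j * n) * s)"] by simp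
      moreover have "real (j * n) * s \<le> (real n)\<^sup>2 * s"
        using that s by (intro mult_right_mono) (auto simp: power2_eq_square intro: mult_right_mono)
      ultimately show ?thesis by linarith
    qed
    from sum_bounded_below[of "{1..n}", OF this] show ?thesis by simp
  qed
  have "0 \<le> 1 - 1 / real n * ?S" using up n by (simp add: field_simps)
  then show "0 \<le> mollify_symbol n s" unfolding mollify_symbol_def by simp
  have "0 \<le> ?S" by (intro sum_nonneg) simp
  then have "1 - 1 / real n * ?S \<le> 1" by simp
  moreover have "exp (- (1 / real n * s)) \<le> 1" using s by simp
  ultimately show "mollify_symbol n s \<le> 1"
    using mult_mono[of "exp (- (1 / real n * s))" 1 "1 - 1 / real n * ?S" 1] \<open>0 \<le> 1 - 1 / real n * ?S\<close>
    unfolding mollify_symbol_def by simp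
  have "1 / real n * (real n * (1 - (real n)\<^sup>2 * s)) \<le> 1 / real n * ?S"
    using low n by (intro mult_left_mono) auto
  then have "1 - 1 / real n * ?S \<le> (real n)\<^sup>2 * s" using n by simp
  then show "mollify_symbol n s \<le> (real n)\<^sup>2 * s * exp (- (1 / real n * s))"
    unfolding mollify_symbol_def by (subst mult.commute) (rule mult_right_mono, simp_all)
qed

lemma mollify_symbol_tendsto:
  assumes s: "s > 0"
  shows "(\<lambda>n. mollify_symbol (Suc n) s) \<longlonglongrightarrow> 1"
proof -
  let ?A = "\<lambda>n. 1 / real (Suc n) * (\<Sum>j=1..Suc n. exp (- (real (j * Suc n) * s)))"
  have inv: "(\<lambda>n. 1 / real (Suc n)) \<longlonglongrightarrow> 0"
    using LIMSEQ_inverse_real_of_nat by (simp add: inverse_eq_divide)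
  have A: "0 \<le> ?A n" "?A n \<le> 1 / s * (1 / real (Suc n))" for n
  proof -
    show "0 \<le> ?A n" by (intro mult_nonneg_nonneg sum_nonneg) auto
    have "exp (- (real (j * Suc n) * s)) \<le> 1 / (real (Suc n) * s)" if "j \<in> {1..Suc n}" for j
    proof -
      let ?x = "real (Suc n) * s"
      have "1 * Suc n \<le> j * Suc n" using that by (intro mult_right_mono) auto
      then have "real (Suc n) \<le> real (j * Suc n)" by (simp only: of_nat_le_iff mult_1)
      then have "?x \<le> real (j * Suc n) * s" using s by (intro mult_right_mono) auto
      then have "exp (- (real (j * Suc n) * s)) \<le> exp (- ?x)" by (simp only: exp_le_cancel_iff neg_le_iff_le)
      also have "\<dots> = 1 / exp ?x" by (simp only: exp_minus inverse_eq_divide)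
      also have "\<dots> \<le> 1 / ?x"
      proof (rule divide_left_mono)
        show "?x \<le> exp ?x" using exp_ge_add_one_self[of ?x] by linarith
        show "0 < exp ?x * ?x" using s by (intro mult_pos_pos) auto
      qed simp
      finally show ?thesis .
    qed
    from sum_bounded_above[of "{1..Suc n}" "\<lambda>j. exp (- (real (j * Suc n) * s))", OF this]
    have "(\<Sum>j=1..Suc n. exp (- (real (j * Suc n) * s))) \<le> real (Suc n) * (1 / (real (Suc n) * s))"
      by (simp only: card_atLeastAtMost diff_Suc_1)
    also have "\<dots> = 1 / s" by simp
    finally have "?A n \<le> 1 / real (Suc n) * (1 / s)"
      by (intro mult_left_mono) auto
    then show "?A n \<le> 1 / s * (1 / real (Suc n))" by (simp only: mult.commute)
  qed
  have "(\<lambda>n. 1 / s * (1 / real (Suc n))) \<longlonglongrightarrow> 1 / s * 0" by (intro tendsto_intros inv)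
  then have up: "(\<lambda>n. 1 / s * (1 / real (Suc n))) \<longlonglongrightarrow> 0" by (simp only: mult_zero_right)
  have "?A \<longlonglongrightarrow> 0"
    by (rule tendsto_sandwich[OF _ _ tendsto_const up]) (use A in \<open>auto simp only: eventually_sequentially\<close>)
  then have "(\<lambda>n. exp (- (1 / real (Suc n) * s)) * (1 - ?A n)) \<longlonglongrightarrow> exp (- (0 * s)) * (1 - 0)"
    by (intro tendsto_intros inv)
  then show ?thesis by (simp add: mollify_symbol_def)
qed

section \<open>The closure of the Laplace transform\<close>

locale laplace_measure =
  fixes M :: "real measure"
  assumes sets_M: "sets M = sets (restrict_space borel {0..})"
    and finite_exp: "\<And>t. t > 0 \<Longrightarrow> (\<integral>\<^sup>+s. ennreal (exp (- (t * s))) \<partial>M) < \<infinity>"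
begin

lemma space_M: "space M = {0..}"
  using sets_eq_imp_space_eq[OF sets_M] by (simp add: space_restrict_space)

lemma borel_measurable_M: "f \<in> borel_measurable borel \<Longrightarrow> f \<in> borel_measurable M"
  unfolding measurable_cong_sets[OF sets_M refl] by (rule measurable_restrict_space1)

lemma singleton_zero_sets: "{0} \<in> sets M"
  unfolding sets_M by (auto simp: sets_restrict_space intro!: image_eqI[of _ _ "{0}"])

lemma AE_positive:
  assumes "emeasure M {0} = 0"
  shows "AE s in M. s > 0"
proof -
  have "AE s in M. s \<notin> {0}"
    using assms singleton_zero_sets by (intro AE_not_in) (simp add: null_sets_def)
  then show ?thesis
    using AE_space[of M] by eventually_elim (auto simp: space_M)
qed

lemma exp_l2_M:
  assumes t: "t > 0"
  shows "(\<lambda>s. of_real (exp (- (t * s)))) \<in> l2 M"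
proof -
  have sq: "(cmod (of_real (exp (- (t * s)))))\<^sup>2 = exp (- ((2 * t) * s))" for s
    by (simp add: power2_eq_square algebra_simps flip: exp_add)
  have "integrable M (\<lambda>s. exp (- ((2 * t) * s)))"
  proof (rule integrableI_bounded)
    show "(\<lambda>s. exp (- ((2 * t) * s))) \<in> borel_measurable M"
      by (rule borel_measurable_M) measurable
    show "(\<integral>\<^sup>+s. ennreal (norm (exp (- ((2 * t) * s)))) \<partial>M) < \<infinity>"
      using finite_exp[of "2 * t"] t by simp
  qed
  moreover have "(\<lambda>s. complex_of_real (exp (- (t * s)))) \<in> borel_measurable M"
    by (rule borel_measurable_M) measurable
  ultimately show ?thesis unfolding l2_def mem_Collect_eq sq by (intro conjI)
qed

lemma laplace_E_plus_l2: "f \<in> E_plus \<Longrightarrow> laplace f \<in> l2 M"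
  by (rule laplace_E_plus_in_l2[OF _ sets_M finite_exp])

abbreviation E_graph :: "((real \<Rightarrow> complex) \<times> (real \<Rightarrow> complex)) set" where
  "E_graph \<equiv> l2_graph R_plus M E_plus laplace"

lemma E_plus_graphI: "f \<in> E_plus \<Longrightarrow> (f, laplace f) \<in> E_graph"
  using E_plus_subset_l2 laplace_E_plus_l2 by (auto simp: l2_graph_def)

lemma graph_laplace_AE:
  assumes fg: "(f, g) \<in> l2_graph R_plus M D laplace" and D: "D \<subseteq> l2 R_plus"
  shows "AE s in M. g s = laplace f s"
proof -
  obtain h where h: "h \<in> D" "AE t in R_plus. f t = h t" "AE s in M. g s = laplace h s"
    and f: "f \<in> l2 R_plus" using fg by (auto simp: l2_graph_def)
  have "h \<in> l2 R_plus" using h(1) D by blast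
  then have "laplace f s = laplace h s" for s
    by (rule laplace_cong_AE[OF l2_measurable[OF f] l2_measurable h(2)])
  with h(3) show ?thesis by simp
qed

text \<open>On functions supported in a fixed \<open>{c..d}\<close> with \<open>c > 0\<close> the transform is bounded by a multiple of
  \<open>exp (- (c * s))\<close>, an element of \<open>l2 M\<close>; so approximation of the function alone is enough.\<close>

lemma closure_graph_C0_inf_plus:
  "l2_closure R_plus M (l2_graph R_plus M C0_inf_plus laplace) = l2_closure R_plus M E_graph"
    (is "l2_closure R_plus M ?G = _")
proof (rule antisym)
  have "?G \<subseteq> E_graph" using C0_inf_plus_subset_E_plus by (fastforce simp: l2_graph_def)
  then show "l2_closure R_plus M ?G \<subseteq> l2_closure R_plus M E_graph" by (rule l2_closure_mono)
  have "E_graph \<subseteq> l2_closure R_plus M ?G"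
  proof clarify
    fix f g assume fg: "(f, g) \<in> E_graph"
    then have l2: "f \<in> l2 R_plus" "g \<in> l2 M" using l2_graph_subset by blast+
    have gL: "AE s in M. g s = laplace f s"
      by (rule graph_laplace_AE[OF fg E_plus_subset_l2])
    obtain h where h: "h \<in> E_plus" "AE t in R_plus. f t = h t" using fg by (auto simp: l2_graph_def)
    then obtain K where K: "compact K" "K \<subseteq> {0<..}" "AE t in R_plus. t \<notin> K \<longrightarrow> h t = 0"
      by (auto simp: E_plus_def)
    obtain a b where ab: "0 < a" "a \<le> b" "K \<subseteq> {a..b}"
    proof (cases "K = {}")
      case True then show ?thesis using that[of 1 1] by auto
    next
      case False
      obtain x where x: "x \<in> K" "\<forall>t\<in>K. x \<le> t" using compact_attains_inf[OF K(1) False] by blast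
      obtain y where y: "y \<in> K" "\<forall>t\<in>K. t \<le> y" using compact_attains_sup[OF K(1) False] by blast
      have "x \<le> y" using x y by blast
      then show ?thesis by (rule that[of x y, rotated]) (use x y K(2) in auto)
    qed
    define k where "k t = indicator {a..b} t *\<^sub>R f t" for t
    have "(\<lambda>t. indicator {a..b} t :: real) \<in> borel_measurable R_plus"
      by (rule borel_measurable_R_plus) measurable
    then have mk: "k \<in> borel_measurable R_plus"
      unfolding k_def[abs_def] using l2_measurable[OF l2(1)] by measurable
    have k: "k \<in> l2 R_plus"
      by (rule l2_of_dominated[OF l2(1) mk]) (auto simp: k_def indicator_def)
    have fk: "AE t in R_plus. f t = k t"
      using h(2) K(3) by eventually_elim (use ab(3) in \<open>auto simp: k_def indicator_def\<close>)
    have Lfk: "laplace f s = laplace k s" for s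
      by (rule laplace_cong_AE[OF l2_measurable[OF l2(1)] mk fk])
    have k0: "\<And>t. t \<notin> {a..b} \<Longrightarrow> k t = 0" by (simp add: k_def)
    let ?c = "a / 2" and ?d = "b + 1"
    have cd: "0 < ?c" "?c < a" "a \<le> b" "b < ?d" using ab by auto
    let ?E = "\<lambda>s. complex_of_real (exp (- (?c * s)))"
    have E: "?E \<in> l2 M" by (rule exp_l2_M[OF cd(1)])
    define C where "C = sqrt (?d - ?c) * l2_norm M ?E"
    have C: "C \<ge> 0" using cd by (simp add: C_def l2_norm_nonneg)
    show "(f, g) \<in> l2_closure R_plus M ?G"
      unfolding l2_closure_iff
    proof (intro conjI l2 allI impI)
      fix e :: real assume e: "e > 0"
      then have "e / (1 + C) > 0" using C by simp
      from smooth_approximation[OF k k0 cd this] obtain \<phi>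
        where \<phi>: "\<phi> \<in> C0_inf_plus" "\<And>t. t \<notin> {?c..?d} \<Longrightarrow> \<phi> t = 0"
          and close: "l2_norm R_plus (\<lambda>t. \<phi> t - k t) < e / (1 + C)" by blast
      let ?n = "l2_norm R_plus (\<lambda>t. \<phi> t - k t)"
      have \<phi>E: "\<phi> \<in> E_plus" and \<phi>l2: "\<phi> \<in> l2 R_plus"
        using \<phi>(1) C0_inf_plus_subset_E_plus E_plus_subset_l2 by auto
      have L\<phi>: "laplace \<phi> \<in> l2 M" by (rule laplace_E_plus_l2[OF \<phi>E])
      have "?n * (1 + C) < e" using close C by (simp add: pos_less_divide_eq)
      then have small: "?n < e" "C * ?n < e"
        using mult_nonneg_nonneg[OF C l2_norm_nonneg[of R_plus "\<lambda>t. \<phi> t - k t"]]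
          l2_norm_nonneg[of R_plus "\<lambda>t. \<phi> t - k t"] by (simp_all add: algebra_simps)
      have cd': "?c \<le> ?d" using cd by simp
      have k0': "\<And>t. t \<notin> {?c..?d} \<Longrightarrow> k t = 0" using k0 cd by auto
      have "l2_norm M (\<lambda>s. laplace \<phi> s - g s) \<le> l2_norm M (\<lambda>s. of_real (sqrt (?d - ?c) * ?n) * ?E s)"
      proof (rule l2_norm_mono[OF l2_scale(1)[OF E] l2_measurable[OF l2_diff[OF L\<phi> l2(2)]]])
        show "AE s in M. cmod (laplace \<phi> s - g s) \<le> cmod (of_real (sqrt (?d - ?c) * ?n) * ?E s)"
          using gL AE_space[of M]
        proof eventually_elim
          case (elim s)
          then have s: "s \<ge> 0" by (simp add: space_M)
          have "laplace \<phi> s - laplace k s = laplace (\<lambda>t. \<phi> t - k t) s"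
            unfolding laplace_def right_diff_distrib
            by (rule Bochner_Integration.integral_diff[symmetric])
               (rule laplace_integrable_supported[OF _ _ cd(1) cd' s]; use \<phi>l2 \<phi>(2) k k0' in blast)+
          moreover have "cmod (laplace (\<lambda>t. \<phi> t - k t) s) \<le> exp (- (?c * s)) * sqrt (?d - ?c) * ?n"
            by (rule laplace_le_supported[OF l2_diff[OF \<phi>l2 k] _ cd(1) cd' s]) (use \<phi>(2) k0' in auto)
          moreover have "cmod (of_real (sqrt (?d - ?c) * ?n) * ?E s) = exp (- (?c * s)) * sqrt (?d - ?c) * ?n"
            using cd' by (simp add: norm_mult l2_norm_nonneg)
          ultimately show ?case using elim Lfk[of s] by simp
        qed
      qed
      also have "\<dots> = C * ?n"
        unfolding l2_scale(2)[OF E] C_def using cd' by (simp add: norm_mult l2_norm_nonneg)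
      finally have "l2_norm M (\<lambda>s. laplace \<phi> s - g s) < e" using small by simp
      moreover have "l2_norm R_plus (\<lambda>t. \<phi> t - f t) = ?n"
        by (rule l2_norm_cong_AE[OF l2_measurable[OF l2_diff[OF \<phi>l2 l2(1)]] l2_measurable[OF l2_diff[OF \<phi>l2 k]]])
           (use fk in \<open>auto elim: eventually_mono\<close>)
      moreover have "(\<phi>, laplace \<phi>) \<in> ?G" using \<phi>(1) \<phi>l2 L\<phi> by (auto simp: l2_graph_def)
      ultimately show "\<exists>(u, v)\<in>?G. l2_norm R_plus (\<lambda>x. u x - f x) < e \<and> l2_norm M (\<lambda>y. v y - g y) < e"
        using small(1) by (intro bexI[of _ "(\<phi>, laplace \<phi>)"]) auto
    qed
  qed
  from l2_closure_mono[OF this] show "l2_closure R_plus M E_graph \<subseteq> l2_closure R_plus M ?G"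
    using l2_closure_idem[OF l2_graph_subset] by (rule order_trans)
qed

text \<open>For \<open>s > 0\<close> the value of the transform at \<open>s\<close> depends continuously on the function.\<close>

lemma closure_graph_is_laplace:
  assumes null: "emeasure M {0} = 0" and fg: "(f, g) \<in> l2_closure R_plus M E_graph"
  shows "AE s in M. g s = laplace f s"
proof -
  obtain u v where uv: "\<And>n. (u n, v n) \<in> E_graph" and l2: "f \<in> l2 R_plus" "g \<in> l2 M"
    and lim: "(\<lambda>n. l2_norm R_plus (\<lambda>x. u n x - f x)) \<longlonglongrightarrow> 0" "(\<lambda>n. l2_norm M (\<lambda>y. v n y - g y)) \<longlonglongrightarrow> 0"
    using fg unfolding l2_closure_def by auto
  have u: "u n \<in> l2 R_plus" and v: "v n \<in> l2 M" for n using uv[of n] l2_graph_subset by blast+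
  have "AE s in M. \<forall>n. v n s = laplace (u n) s"
    unfolding AE_all_countable by (intro allI graph_laplace_AE[OF uv E_plus_subset_l2])
  then have pt: "AE s in M. (\<lambda>n. v n s) \<longlonglongrightarrow> laplace f s"
    using AE_positive[OF null]
  proof eventually_elim
    case (elim s)
    have "(\<lambda>n. l2_norm R_plus (\<lambda>x. u n x - f x) / sqrt (2 * s)) \<longlonglongrightarrow> 0 / sqrt (2 * s)"
      using elim by (intro tendsto_intros lim) auto
    then have up: "(\<lambda>n. l2_norm R_plus (\<lambda>x. u n x - f x) / sqrt (2 * s)) \<longlonglongrightarrow> 0" by simp
    have "(\<lambda>n. laplace (u n) s - laplace f s) \<longlonglongrightarrow> 0"
    proof (rule Lim_null_comparison[OF _ up], rule always_eventually, rule allI)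
      fix n
      show "cmod (laplace (u n) s - laplace f s) \<le> l2_norm R_plus (\<lambda>x. u n x - f x) / sqrt (2 * s)"
        using laplace_le[OF l2_diff[OF u l2(1)] elim(2), of n] laplace_diff[OF u l2(1) elim(2), of n] by simp
    qed
    then show ?case using elim(1) by (simp add: LIM_zero_iff)
  qed
  show ?thesis by (rule l2_limit_unique_AE[OF v l2(2) lim(2) pt])
qed

text \<open>The bound on point evaluation has the factor \<open>1 / sqrt s\<close>, which may fail to be square-integrable both
  near \<open>0\<close> and at infinity.  The symbol compensates for both, and the transform of a
  regularised function is dominated by its \<open>l2 R_plus\<close> norm times a fixed element of \<open>l2 M\<close>.  Truncations
  of \<open>f\<close> therefore converge in both components after regularisation.\<close>

lemma mollify_in_closure:
  assumes null: "emeasure M {0} = 0" and f: "f \<in> l2 R_plus" and Lf: "laplace f \<in> l2 M" and n: "n > 0"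
  shows "(\<lambda>s. of_real (mollify_symbol n s) * laplace f s) \<in> l2 M"
    and "(mollify n f, \<lambda>s. of_real (mollify_symbol n s) * laplace f s) \<in> l2_closure R_plus M E_graph"
proof -
  let ?W = "mollify n f" and ?LW = "\<lambda>s. of_real (mollify_symbol n s) * laplace f s"
  let ?T = "\<lambda>N. mollify n (truncate N f)"
  let ?E = "\<lambda>s. complex_of_real (exp (- (1 / (2 * real n) * s)))"
  have E: "?E \<in> l2 M" using n by (intro exp_l2_M) simp
  have TE: "?T N \<in> E_plus" for N by (rule mollify_truncate_in_E_plus[OF f n])
  have LT: "laplace (?T N) \<in> l2 M" for N by (rule laplace_E_plus_l2[OF TE])
  have bnd: "cmod (laplace (mollify n r) s) \<le> real n ^ 3 * exp (- (1 / (2 * real n) * s)) * l2_norm R_plus r"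
    if r: "r \<in> l2 R_plus" and s: "s > 0" for r s
  proof -
    let ?x = "exp (- (1 / (2 * real n) * s))"
    have n1: "real n \<ge> 1" using n by simp
    have ee: "exp (- (1 / real n * s)) = ?x * ?x" using n by (simp add: field_simps flip: exp_add)
    (* half of the exponential absorbs the factor sqrt s that remains of s / sqrt s *)
    have sx: "sqrt s * ?x \<le> real n"
    proof -
      have "s / real n \<le> exp (s / real n)" using exp_ge_add_one_self[of "s / real n"] by linarith
      then have "s * exp (- (1 / real n * s)) \<le> real n"
        using n by (simp add: exp_minus field_simps)
      then have "sqrt (s * exp (- (1 / real n * s))) \<le> sqrt (real n)" by (rule real_sqrt_le_mono)
      moreover have "sqrt (s * exp (- (1 / real n * s))) = sqrt s * ?x" by (simp only: ee real_sqrt_mult) simp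
      moreover have "sqrt (real n) \<le> real n" using n1 by (simp add: sqrt_le_D real_le_lsqrt power2_eq_square)
      ultimately show ?thesis by linarith
    qed
    have "cmod (laplace (mollify n r) s) = mollify_symbol n s * cmod (laplace r s)"
      using mollify_symbol_bounds(1)[OF n, of s] s by (simp add: laplace_mollify[OF r s] norm_mult)
    also have "\<dots> \<le> ((real n)\<^sup>2 * s * exp (- (1 / real n * s))) * (l2_norm R_plus r / sqrt s)"
    proof (rule mult_mono)
      have "l2_norm R_plus r / sqrt (2 * s) \<le> l2_norm R_plus r / sqrt s"
        using s by (intro divide_left_mono) (auto simp: l2_norm_nonneg)
      with laplace_le[OF r s] show "cmod (laplace r s) \<le> l2_norm R_plus r / sqrt s" by linarith
    qed (use s mollify_symbol_bounds(3)[OF n, of s] in auto)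
    also have "\<dots> = (real n)\<^sup>2 * (s / sqrt s * ?x) * ?x * l2_norm R_plus r"
      unfolding ee by simp
    also have "s / sqrt s = sqrt s" using s by (simp add: real_div_sqrt)
    also have "(real n)\<^sup>2 * (sqrt s * ?x) * ?x * l2_norm R_plus r \<le> (real n)\<^sup>2 * real n * ?x * l2_norm R_plus r"
      using sx by (intro mult_right_mono mult_left_mono) (auto simp: l2_norm_nonneg)
    finally show ?thesis by (simp add: power2_eq_square power3_eq_cube)
  qed
  have T_lim: "(\<lambda>N. l2_norm R_plus (\<lambda>t. ?T N t - ?W t)) \<longlonglongrightarrow> 0"
  proof -
    have "(\<lambda>N. 2 * l2_norm R_plus (\<lambda>t. f t - truncate N f t)) \<longlonglongrightarrow> 2 * 0"
      by (intro tendsto_intros truncate_l2(2)[OF f])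
    then have up: "(\<lambda>N. 2 * l2_norm R_plus (\<lambda>t. f t - truncate N f t)) \<longlonglongrightarrow> 0" by simp
    have "l2_norm R_plus (\<lambda>t. ?T N t - ?W t) \<le> 2 * l2_norm R_plus (\<lambda>t. f t - truncate N f t)" for N
      using mollify_norm_le[OF l2_diff[OF f truncate_l2(1)[OF f]], of n N]
      by (simp add: mollify_diff l2_norm_minus_commute[of R_plus "?T N"])
    then show ?thesis
      by (intro tendsto_sandwich[OF _ _ tendsto_const up]) (auto simp: l2_norm_nonneg)
  qed
  have "mollify_symbol n \<in> borel_measurable M"
    unfolding mollify_symbol_def[abs_def] by (rule borel_measurable_M) measurable
  then have mW: "?LW \<in> borel_measurable M"
    using l2_measurable[OF Lf] by measurable
  show LW: "?LW \<in> l2 M"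
  proof (rule l2_of_dominated[OF Lf mW])
    show "AE s in M. cmod (?LW s) \<le> cmod (laplace f s)"
      using AE_space[of M]
    proof eventually_elim
      case (elim s)
      then have "s \<ge> 0" by (simp add: space_M)
      then show ?case
        using mollify_symbol_bounds(1,2)[OF n, of s] by (simp add: norm_mult mult_left_le_one_le)
    qed
  qed
  have "(\<lambda>N. l2_norm M (\<lambda>s. laplace (?T N) s - ?LW s)) \<longlonglongrightarrow> 0"
  proof -
    let ?b = "\<lambda>N. real n ^ 3 * l2_norm R_plus (\<lambda>t. f t - truncate N f t)"
    have "(\<lambda>N. ?b N * l2_norm M ?E) \<longlonglongrightarrow> (real n ^ 3 * 0) * l2_norm M ?E"
      by (intro tendsto_intros truncate_l2(2)[OF f])
    then have up: "(\<lambda>N. ?b N * l2_norm M ?E) \<longlonglongrightarrow> 0" by simp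
    have "l2_norm M (\<lambda>s. laplace (?T N) s - ?LW s) \<le> ?b N * l2_norm M ?E" for N
    proof -
      note d = l2_diff[OF f truncate_l2(1)[OF f, of N]]
      have "l2_norm M (\<lambda>s. laplace (?T N) s - ?LW s) \<le> l2_norm M (\<lambda>s. of_real (?b N) * ?E s)"
      proof (rule l2_norm_mono[OF l2_scale(1)[OF E] l2_measurable[OF l2_diff[OF LT LW]]])
        show "AE s in M. cmod (laplace (?T N) s - ?LW s) \<le> cmod (of_real (?b N) * ?E s)"
          using AE_positive[OF null]
        proof eventually_elim
          case (elim s)
          have "?LW s - laplace (?T N) s = laplace (mollify n (\<lambda>t. f t - truncate N f t)) s"
            unfolding mollify_diff laplace_mollify[OF f elim, symmetric]
            by (intro laplace_diff[symmetric] mollify_l2 truncate_l2(1) f elim)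
          then have "cmod (laplace (?T N) s - ?LW s) \<le> ?b N * exp (- (1 / (2 * real n) * s))"
            using bnd[OF d elim] by (simp only: norm_minus_commute[of "laplace (?T N) s"] ac_simps)
          then show ?case by (simp add: norm_mult norm_power l2_norm_nonneg)
        qed
      qed
      then show ?thesis
        unfolding l2_scale(2)[OF E] by (simp add: norm_mult norm_power l2_norm_nonneg)
    qed
    then show ?thesis
      by (intro tendsto_sandwich[OF _ _ tendsto_const up]) (auto simp: l2_norm_nonneg)
  qed
  with T_lim show "(?W, ?LW) \<in> l2_closure R_plus M E_graph"
    by (rule l2_closureI[OF mollify_l2[OF f] LW E_plus_graphI[OF TE]])
qed

text \<open>The regularised pairs lie in the closure and converge to \<open>(f, g)\<close>: the symbols are bounded by \<open>1\<close> and tend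
  to \<open>1\<close> off the null set \<open>{0}\<close>.\<close>

lemma maximal_in_closure:
  assumes null: "emeasure M {0} = 0" and f: "f \<in> l2 R_plus" and g: "g \<in> l2 M" and Lf: "laplace f \<in> l2 M"
    and gL: "AE s in M. g s = laplace f s"
  shows "(f, g) \<in> l2_closure R_plus M E_graph"
proof -
  let ?v = "\<lambda>n s. of_real (mollify_symbol (Suc n) s) * laplace f s"
  have v: "?v n \<in> l2 M" and cl: "(mollify (Suc n) f, ?v n) \<in> l2_closure R_plus M E_graph" for n
    using mollify_in_closure[OF null f Lf, of "Suc n"] by auto
  have "(\<lambda>n. l2_norm M (\<lambda>s. ?v n s - g s)) \<longlonglongrightarrow> 0"
  proof (rule l2_dominated_convergence[OF Lf l2_measurable[OF l2_diff[OF v g]]])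
    show "AE s in M. (\<lambda>n. ?v n s - g s) \<longlonglongrightarrow> 0"
      using gL AE_positive[OF null]
    proof eventually_elim
      case (elim s)
      have "(\<lambda>n. ?v n s - g s) \<longlonglongrightarrow> of_real 1 * laplace f s - g s"
        by (intro tendsto_intros mollify_symbol_tendsto elim)
      then show ?case using elim by simp
    qed
    show "AE s in M. cmod (?v n s - g s) \<le> cmod (laplace f s)" for n
      using gL AE_space[of M]
    proof eventually_elim
      case (elim s)
      then have s: "s \<ge> 0" by (simp add: space_M)
      have "?v n s - g s = of_real (mollify_symbol (Suc n) s - 1) * laplace f s"
        using elim(1) by (simp add: left_diff_distrib)
      moreover have "\<bar>mollify_symbol (Suc n) s - 1\<bar> \<le> 1"
        using mollify_symbol_bounds(1,2)[of "Suc n" s] s by auto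
      ultimately show ?case by (simp only: norm_mult norm_of_real) (rule mult_left_le_one_le; simp)
    qed
  qed
  then have "(f, g) \<in> l2_closure R_plus M (l2_closure R_plus M E_graph)"
    by (rule l2_closureI[OF f g cl mollify_tendsto[OF f]])
  then show ?thesis using l2_closure_idem[OF l2_graph_subset] by blast
qed

lemma closure_eq_maximal:
  assumes null: "emeasure M {0} = 0"
  shows "l2_closure R_plus M E_graph = l2_graph R_plus M {f \<in> l2 R_plus. laplace f \<in> l2 M} laplace"
    (is "_ = l2_graph R_plus M ?D laplace")
proof (rule antisym)
  show "l2_closure R_plus M E_graph \<subseteq> l2_graph R_plus M ?D laplace"
  proof clarify
    fix f g assume fg: "(f, g) \<in> l2_closure R_plus M E_graph"
    then have l2: "f \<in> l2 R_plus" "g \<in> l2 M" by (auto simp: l2_closure_iff)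
    have gL: "AE s in M. g s = laplace f s" by (rule closure_graph_is_laplace[OF null fg])
    have "laplace f \<in> l2 M"
      by (rule l2_of_dominated[OF l2(2) borel_measurable_M[OF laplace_measurable[OF l2_measurable[OF l2(1)]]]])
         (use gL in \<open>auto elim: eventually_mono\<close>)
    with l2 gL show "(f, g) \<in> l2_graph R_plus M ?D laplace"
      by (auto simp: l2_graph_def intro!: bexI[of _ f])
  qed
  show "l2_graph R_plus M ?D laplace \<subseteq> l2_closure R_plus M E_graph"
  proof clarify
    fix f g assume fg: "(f, g) \<in> l2_graph R_plus M ?D laplace"
    then obtain h where h: "h \<in> l2 R_plus" "laplace h \<in> l2 M" "AE t in R_plus. f t = h t"
      and l2: "f \<in> l2 R_plus" "g \<in> l2 M" by (auto simp: l2_graph_def)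
    have "laplace f = laplace h"
      by (rule ext, rule laplace_cong_AE[OF l2_measurable[OF l2(1)] l2_measurable[OF h(1)] h(3)])
    with h(2) have Lf: "laplace f \<in> l2 M" by simp
    have "AE s in M. g s = laplace f s" by (rule graph_laplace_AE[OF fg]) auto
    then show "(f, g) \<in> l2_closure R_plus M E_graph" by (rule maximal_in_closure[OF null l2 Lf])
  qed
qed

text \<open>Spreading a fixed mass over \<open>{n..2 n}\<close> makes the function small in the \<open>L\<^sup>2\<close> sense, while the
  transform keeps its value at \<open>0\<close> and tends to \<open>0\<close> elsewhere.\<close>

lemma closable_imp_null:
  assumes cl: "l2_closable R_plus M E_graph"
  shows "emeasure M {0} = 0"
proof -
  define u where "u n t = of_real (1 / real (Suc n)) * complex_of_real (indicator {real (Suc n)..2 * real (Suc n)} t)"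
    for n t
  have I: "(\<lambda>t. complex_of_real (indicator {real (Suc n)..2 * real (Suc n)} t)) \<in> l2 R_plus"
    "l2_norm R_plus (\<lambda>t. complex_of_real (indicator {real (Suc n)..2 * real (Suc n)} t)) = sqrt (real (Suc n))" for n
    using indicator_Icc_l2[of "real (Suc n)" "2 * real (Suc n)"] by simp_all
  have u: "u n \<in> l2 R_plus" for n unfolding u_def[abs_def] by (rule l2_scale(1)[OF I(1)])
  have un: "l2_norm R_plus (u n) = 1 / sqrt (real (Suc n))" for n
  proof -
    have "l2_norm R_plus (u n) = 1 / real (Suc n) * sqrt (real (Suc n))"
      unfolding u_def[abs_def] by (subst l2_scale(2)[OF I(1)], subst I(2)) (simp only: norm_of_real, simp)
    also have "\<dots> = 1 / sqrt (real (Suc n))" by (simp add: real_div_sqrt field_simps del: of_nat_Suc)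
    finally show ?thesis .
  qed
  have u0: "\<And>t. t \<notin> {real (Suc n)..2 * real (Suc n)} \<Longrightarrow> u n t = 0" for n by (simp add: u_def)
  have uE: "u n \<in> E_plus" for n by (rule supported_in_E_plus[OF u _ u0]) auto
  have Lu: "cmod (laplace (u n) s) \<le> exp (- (real (Suc n) * s))" if "s \<ge> 0" for n s
  proof -
    have "cmod (laplace (u n) s) \<le> exp (- (real (Suc n) * s)) * sqrt (2 * real (Suc n) - real (Suc n)) * l2_norm R_plus (u n)"
      by (rule laplace_le_supported[OF u u0 _ _ that]) auto
    then show ?thesis by (simp add: un del: of_nat_Suc)
  qed
  have L0: "laplace (u n) 0 = 1" for n
  proof -
    have "laplace (u n) 0 = of_real (1 / real (Suc n)) * (\<integral>t. complex_of_real (indicator {real (Suc n)..2 * real (Suc n)} t) \<partial>R_plus)"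
      unfolding laplace_def u_def by simp
    also have "(\<integral>t. complex_of_real (indicator {real (Suc n)..2 * real (Suc n)} t) \<partial>R_plus)
        = (\<integral>t. complex_of_real (indicator {real (Suc n)..2 * real (Suc n)} t) \<partial>lborel)"
      by (subst integral_restrict_space, simp, rule Bochner_Integration.integral_cong) (auto simp: indicator_def)
    also have "\<dots> = of_real (real (Suc n))" by (simp del: of_nat_Suc)
    finally show ?thesis by (simp del: of_nat_Suc)
  qed
  define g where "g s = complex_of_real (indicator {0} s)" for s :: real
  have mg: "g \<in> borel_measurable M" unfolding g_def[abs_def] by (rule borel_measurable_M) measurable
  let ?E = "\<lambda>s. complex_of_real (exp (- (1 * s)))"
  have E: "?E \<in> l2 M" by (rule exp_l2_M) simp
  have g: "g \<in> l2 M"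
    by (rule l2_of_dominated[OF E mg]) (auto simp: g_def indicator_def)
  have zero: "(\<lambda>_. 0) \<in> l2 M'" for M' :: "real measure" by (simp add: l2_def)
  have u_lim: "(\<lambda>n. l2_norm R_plus (\<lambda>t. u n t - 0)) \<longlonglongrightarrow> 0"
  proof -
    have "(\<lambda>n. sqrt (1 / real (Suc n))) \<longlonglongrightarrow> sqrt 0"
      using LIMSEQ_inverse_real_of_nat by (intro tendsto_intros) (simp add: inverse_eq_divide)
    then show ?thesis by (simp add: un real_sqrt_divide del: of_nat_Suc)
  qed
  have v_lim: "(\<lambda>n. l2_norm M (\<lambda>s. laplace (u n) s - g s)) \<longlonglongrightarrow> 0"
  proof (rule l2_dominated_convergence[OF E l2_measurable[OF l2_diff[OF laplace_E_plus_l2[OF uE] g]]])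
    show "AE s in M. (\<lambda>n. laplace (u n) s - g s) \<longlonglongrightarrow> 0"
    proof (rule AE_I2)
      fix s assume "s \<in> space M"
      then have "s \<ge> 0" by (simp add: space_M)
      then consider "s = 0" | "s > 0" by linarith
      then show "(\<lambda>n. laplace (u n) s - g s) \<longlonglongrightarrow> 0"
      proof cases
        case 1 then show ?thesis by (simp add: L0 g_def)
      next
        case 2
        then have "norm (exp (- s)) < 1" by simp
        from LIMSEQ_Suc[OF LIMSEQ_power_zero[OF this]]
        have up: "(\<lambda>n. exp (- (real (Suc n) * s))) \<longlonglongrightarrow> 0"
          by (simp add: exp_of_nat_mult[symmetric] del: of_nat_Suc power_Suc)
        have "(\<lambda>n. laplace (u n) s) \<longlonglongrightarrow> 0"
          by (rule Lim_null_comparison[OF _ up]) (use Lu[of s] 2 in \<open>auto simp del: of_nat_Suc\<close>)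
        then show ?thesis using 2 by (simp add: g_def)
      qed
    qed
    show "AE s in M. cmod (laplace (u n) s - g s) \<le> cmod (?E s)" for n
    proof (rule AE_I2)
      fix s assume "s \<in> space M"
      then have s: "s \<ge> 0" by (simp add: space_M)
      show "cmod (laplace (u n) s - g s) \<le> cmod (?E s)"
      proof (cases "s = 0")
        case False
        have "1 * s \<le> real (Suc n) * s" using s by (intro mult_right_mono) auto
        then have "exp (- (real (Suc n) * s)) \<le> exp (- (1 * s))" by (simp only: exp_le_cancel_iff neg_le_iff_le)
        with Lu[OF s, of n] have "cmod (laplace (u n) s) \<le> exp (- (1 * s))" by (rule order_trans)
        then show ?thesis using False by (simp add: g_def)
      qed (simp add: L0 g_def)
    qed
  qed
  have "((\<lambda>_. 0), g) \<in> l2_closure R_plus M E_graph"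
    by (rule l2_closureI[OF zero g E_plus_graphI[OF uE] u_lim v_lim])
  moreover have "((\<lambda>_. 0), (\<lambda>_. 0)) \<in> l2_closure R_plus M E_graph"
  proof -
    have z: "(\<lambda>_. 0) \<in> E_plus" by (rule supported_in_E_plus[OF zero, of 1 1]) auto
    have "laplace (\<lambda>_. 0) = (\<lambda>_. 0)" by (simp add: laplace_def[abs_def])
    then have "((\<lambda>_. 0), (\<lambda>_. 0)) \<in> E_graph" using E_plus_graphI[OF z] by simp
    then show ?thesis
      by (intro l2_closureI[where u="\<lambda>_ _. 0" and v="\<lambda>_ _. 0"] zero) (simp_all add: l2_norm_def)
  qed
  ultimately have "AE s in M. g s = 0"
    using cl unfolding l2_closable_def l2_single_valued_def by blast
  then have "AE s in M. s \<notin> {0}" by (auto simp: g_def indicator_def elim: eventually_mono)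
  then show ?thesis using singleton_zero_sets by (simp add: AE_iff_measurable[OF _ refl] space_M cong: conj_cong)
qed

lemma null_imp_closable:
  assumes null: "emeasure M {0} = 0"
  shows "l2_closable R_plus M E_graph"
  unfolding l2_closable_def l2_single_valued_def
proof (intro allI impI)
  fix f g f' g'
  assume 1: "(f, g) \<in> l2_closure R_plus M E_graph" and 2: "(f', g') \<in> l2_closure R_plus M E_graph"
    and ff': "AE x in R_plus. f x = f' x"
  have "laplace f s = laplace f' s" for s
    using 1 2 by (intro laplace_cong_AE[OF _ _ ff'] l2_measurable) (auto simp: l2_closure_iff)
  then show "AE s in M. g s = g' s"
    using closure_graph_is_laplace[OF null 1] closure_graph_is_laplace[OF null 2]
    by (auto elim: eventually_elim2)
qed

end

theorem theorem3p9:
  fixes M :: "real measure" and D :: "(real \<Rightarrow> complex) set"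
  assumes "sets M = sets (restrict_space borel {0..})"
    and "\<And>K. compact K \<Longrightarrow> K \<subseteq> {0..} \<Longrightarrow> emeasure M K < \<infinity>"
    and "\<And>t. t > 0 \<Longrightarrow> (\<integral>\<^sup>+s. ennreal (exp (- (t * s))) \<partial>M) < \<infinity>"
    and "D = E_plus \<or> D = C0_inf_plus"
  shows "(l2_closable R_plus M (l2_graph R_plus M D laplace) \<longleftrightarrow> emeasure M {0} = 0) \<and>
    (emeasure M {0} = 0 \<longrightarrow>
     (\<exists>k::real. k > 0 \<and> (\<integral>\<^sup>+s. ennreal ((1 + s) powr (- k)) \<partial>M) < \<infinity>) \<longrightarrow>
     l2_closure R_plus M (l2_graph R_plus M D laplace) =
       l2_graph R_plus M {f \<in> l2 R_plus. laplace f \<in> l2 M} laplace)"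
proof -
  interpret laplace_measure M using assms(1,3) by unfold_locales
  have closure: "l2_closure R_plus M (l2_graph R_plus M D laplace) = l2_closure R_plus M E_graph"
    using assms(4) closure_graph_C0_inf_plus by auto
  then have "l2_closable R_plus M (l2_graph R_plus M D laplace) \<longleftrightarrow> l2_closable R_plus M E_graph"
    by (simp add: l2_closable_def)
  with closure show ?thesis
    using closable_imp_null null_imp_closable closure_eq_maximal by auto
qed

end
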